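(* Let $n\geq 6$ be an integer. Then $A085680(n+1)=a(n)$, where \[ a(n)=\begin{cases}\frac{1}{10}(n^2+n+20) & \text{if } n\equiv 0 \text{ or } 4 \pmod 5,\\[2pt] \frac{1}{10}(n^2+n+18) & \text{if } n\equiv 1 \text{ or } 3 \pmod 5,\\[2pt] \frac{1}{10}(n^2+n+14) & \text{if } n\equiv 2 \pmod 5.\end{cases} \]
   Context: For an integer $m\ge 2$, $A085680(m)$ denotes the maximum number of binary vectors of length $m$ and constant weight $2$ forming a code that can correct a single adjacent transposition; equivalently, $A085680(m)=\rho(\Gamma_m)$, where $\Gamma_m$ is the graph whose vertices are the binary vectors of length $m$ with exactly two 1's, two vertices being adjacent iff one is obtained from the other by swapping a pair of adjacent bits. ($\Gamma_m$ is isomorphic to the 2-token graph $F_2(P_m)$ of the path $P_m$: vertices are 2-subsets of $\{1,\dots,m\}$, adjacent iff their symmetric difference is an edge $\{i,i+1\}$ of the path.) A packing set of a graph $G$ is a set $S\subseteq V(G)$ such that any two distinct $u,v\in S$ satisfy $d_G(u,v)\ge 3$; the packing number $\rho(G)$ is the maximum cardinality of a packing set of $G$. *)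

theory Defs
  imports Complex_Main "Graph_Theory.Graph_Theory"
begin

section \<open>Distance, packing sets and the packing number\<close>

text \<open>Number of arcs on a shortest walk; it is infinite if there is no walk.\<close>

definition graph_dist :: "('a, 'b) pre_digraph \<Rightarrow> 'a \<Rightarrow> 'a \<Rightarrow> ereal" where
  "graph_dist G u v = wf_digraph.\<mu> G (\<lambda>_. 1) u v"

definition packing_set :: "('a, 'b) pre_digraph \<Rightarrow> 'a set \<Rightarrow> bool" where
  "packing_set G S \<longleftrightarrow>
     S \<subseteq> verts G \<and> (\<forall>u\<in>S. \<forall>v\<in>S. u \<noteq> v \<longrightarrow> graph_dist G u v \<ge> 3)"

text \<open>Meaningful for finite graphs only, since it is a \<^const>\<open>Max\<close>.\<close>

definition packing_number :: "('a, 'b) pre_digraph \<Rightarrow> nat" where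
  "packing_number G = Max (card ` {S. packing_set G S})"


section \<open>The graph of adjacent transpositions on vectors of weight two\<close>

definition swap_adjacent :: "nat \<Rightarrow> bool list \<Rightarrow> bool list" where
  "swap_adjacent i u = u[i := u ! Suc i, Suc i := u ! i]"

definition weight2_vectors :: "nat \<Rightarrow> bool list set" where
  "weight2_vectors m = {u. length u = m \<and> count_list u True = 2}"

text \<open>
  An undirected edge is the pair of arcs \<open>(u, v)\<close> and \<open>(v, u)\<close>. Swapping two equal bits leaves
  the vector unchanged; the condition \<open>u \<noteq> v\<close> excludes the resulting loops.
\<close>

definition transposition_graph :: "nat \<Rightarrow> bool list pair_pre_digraph" where
  "transposition_graph m =
     \<lparr> pverts = weight2_vectors m,
       parcs = {(u, v). u \<in> weight2_vectors m \<and> v \<in> weight2_vectors m \<and> u \<noteq> v \<and>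
                        (\<exists>i. Suc i < m \<and> v = swap_adjacent i u)} \<rparr>"

definition A085680 :: "nat \<Rightarrow> nat" where
  "A085680 m = packing_number (with_proj (transposition_graph m))"

definition A085680_formula :: "nat \<Rightarrow> real" where
  "A085680_formula n = (if n mod 5 \<in> {0, 4} then (real n ^ 2 + real n + 20) / 10
          else if n mod 5 \<in> {1, 3} then (real n ^ 2 + real n + 18) / 10
          else (real n ^ 2 + real n + 14) / 10)"


section \<open>The transposition graph is a finite simple graph\<close>

lemma length_swap_adjacent [simp]: "length (swap_adjacent i u) = length u"
  by (simp add: swap_adjacent_def)

lemma swap_adjacent_swap_adjacent [simp]:
  "Suc i < length u \<Longrightarrow> swap_adjacent i (swap_adjacent i u) = u"
  by (rule nth_equalityI) (simp_all add: swap_adjacent_def nth_list_update)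

lemma count_list_swap_adjacent:
  assumes "Suc i < length u"
  shows "count_list (swap_adjacent i u) x = count_list u x"
proof -
  have "mset (swap_adjacent i u) = mset u"
    using mset_swap[of i u "Suc i"] mset_swap[of "Suc i" u i] assms
    by (simp add: swap_adjacent_def)
  then show ?thesis
    by (metis count_mset)
qed

lemma swap_adjacent_in_weight2_vectors:
  "u \<in> weight2_vectors m \<Longrightarrow> Suc i < m \<Longrightarrow> swap_adjacent i u \<in> weight2_vectors m"
  by (simp add: weight2_vectors_def count_list_swap_adjacent)

lemma finite_weight2_vectors: "finite (weight2_vectors m)"
proof (rule finite_subset)
  show "weight2_vectors m \<subseteq> {u. set u \<subseteq> UNIV \<and> length u = m}"
    by (auto simp: weight2_vectors_def)
qed (rule finite_lists_length_eq, simp)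

lemma pverts_transposition_graph [simp]: "pverts (transposition_graph m) = weight2_vectors m"
  by (simp add: transposition_graph_def)

lemma parcs_transposition_graph:
  "(u, v) \<in> parcs (transposition_graph m) \<longleftrightarrow>
     u \<in> weight2_vectors m \<and> v \<in> weight2_vectors m \<and> u \<noteq> v \<and>
     (\<exists>i. Suc i < m \<and> v = swap_adjacent i u)"
  by (simp add: transposition_graph_def)

lemma sym_parcs_transposition_graph:
  "(u, v) \<in> parcs (transposition_graph m) \<Longrightarrow> (v, u) \<in> parcs (transposition_graph m)"
proof -
  assume "(u, v) \<in> parcs (transposition_graph m)"
  then obtain i where *: "u \<in> weight2_vectors m" "v \<in> weight2_vectors m" "u \<noteq> v"
      "Suc i < m" "v = swap_adjacent i u"
    by (auto simp: parcs_transposition_graph)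
  then have "u = swap_adjacent i v"
    by (simp add: weight2_vectors_def)
  then show ?thesis
    using * unfolding parcs_transposition_graph by blast
qed

lemma pair_graph_transposition_graph: "pair_graph (transposition_graph m)"
proof
  show "finite (parcs (transposition_graph m))"
    by (rule finite_subset[of _ "weight2_vectors m \<times> weight2_vectors m"])
      (auto simp: parcs_transposition_graph finite_weight2_vectors)
  show "symmetric (with_proj (transposition_graph m))"
    unfolding symmetric_def arcs_ends_def
    by (auto intro!: symI sym_parcs_transposition_graph simp: arc_to_ends_def)
qed (auto simp: parcs_transposition_graph finite_weight2_vectors)

lemma graph_transposition_graph: "graph (with_proj (transposition_graph m))"
  by (rule pair_graph.pair_graphD_graph[OF pair_graph_transposition_graph])


section \<open>Codes correcting a single adjacent transposition\<close>

definition received_words :: "bool list \<Rightarrow> bool list set" where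
  "received_words u = insert u {swap_adjacent i u | i. Suc i < length u}"

definition corrects_adjacent_transposition :: "bool list set \<Rightarrow> bool" where
  "corrects_adjacent_transposition C \<longleftrightarrow>
     (\<forall>u\<in>C. \<forall>v\<in>C. u \<noteq> v \<longrightarrow> received_words u \<inter> received_words v = {})"

lemma graph_dist_ge_3_iff:
  assumes "wf_digraph G"
  shows "graph_dist G u v \<ge> 3 \<longleftrightarrow> (\<forall>p. pre_digraph.awalk G u p v \<longrightarrow> length p \<ge> 3)"
proof -
  interpret wf_digraph G by fact
  have cost: "awalk_cost (\<lambda>_. 1) p = real (length p)" for p :: "'b list"
    by (induction p) (auto simp: awalk_cost_def)
  show ?thesis
    by (auto simp: graph_dist_def \<mu>_def le_INF_iff cost)
qed

lemma received_words_eq: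
  assumes "u \<in> weight2_vectors m"
  shows "received_words u = insert u {v. (u, v) \<in> parcs (transposition_graph m)}"
proof -
  have "length u = m"
    using assms by (simp add: weight2_vectors_def)
  then show ?thesis
    using assms swap_adjacent_in_weight2_vectors[OF assms]
    unfolding received_words_def parcs_transposition_graph by blast
qed

lemma packing_set_transposition_graph_iff:
  "packing_set (with_proj (transposition_graph m)) C \<longleftrightarrow>
     C \<subseteq> weight2_vectors m \<and> corrects_adjacent_transposition C"
proof -
  let ?G = "transposition_graph m"
  interpret pair_graph ?G by (rule pair_graph_transposition_graph)
  have wf: "wf_digraph (with_proj ?G)" by unfold_locales
  have key: "graph_dist (with_proj ?G) u v \<ge> 3 \<longleftrightarrow> received_words u \<inter> received_words v = {}"
    if uv: "u \<in> weight2_vectors m" "v \<in> weight2_vectors m" "u \<noteq> v" for u v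
  proof -
    have "(\<exists>p. awalk u p v \<and> length p < 3) \<longleftrightarrow> received_words u \<inter> received_words v \<noteq> {}"
      (is "?L \<longleftrightarrow> ?R")
    proof
      assume ?L
      then obtain p where p: "awalk u p v" "length p < 3" by blast
      then consider "p = []" | e where "p = [e]" | e f where "p = [e, f]"
        by (cases p; cases "tl p") (auto simp: Suc_lessI numeral_3_eq_3)
      then show ?R
      proof cases
        case 1
        then show ?thesis using p(1) uv by (simp add: awalk_Nil_iff)
      next
        case 2
        then have "(u, v) \<in> parcs ?G"
          using p(1) by (auto simp: awalk_Cons_iff awalk_Nil_iff)
        then show ?thesis using uv by (auto simp: received_words_eq)
      next
        case 3
        define w where "w = snd e"
        have "(u, w) \<in> parcs ?G" "(w, v) \<in> parcs ?G"
          using p(1) 3 by (cases e; cases f; auto simp: awalk_Cons_iff awalk_Nil_iff w_def)+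
        then have "w \<in> received_words u" "w \<in> received_words v"
          using uv by (simp_all add: received_words_eq sym_parcs_transposition_graph)
        then show ?thesis by blast
      qed
    next
      assume ?R
      then obtain w where "w \<in> received_words u" "w \<in> received_words v" by blast
      then have "w = u \<or> (u, w) \<in> parcs ?G" "w = v \<or> (w, v) \<in> parcs ?G"
        using uv by (auto simp: received_words_eq intro: sym_parcs_transposition_graph)
      then consider "(u, v) \<in> parcs ?G" | "(u, w) \<in> parcs ?G" "(w, v) \<in> parcs ?G"
        using uv(3) by auto
      then show ?L
      proof cases
        case 1
        then have "awalk u [(u, v)] v"
          using uv by (auto simp: awalk_Cons_iff awalk_Nil_iff)
        then show ?thesis by (intro exI[of _ "[(u, v)]"]) simp
      next
        case 2
        then have "awalk u [(u, w), (w, v)] v"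
          using uv by (auto simp: awalk_Cons_iff awalk_Nil_iff)
        then show ?thesis by (intro exI[of _ "[(u, w), (w, v)]"]) simp
      qed
    qed
    then show ?thesis
      unfolding graph_dist_ge_3_iff[OF wf] by (metis not_le)
  qed
  show ?thesis
    unfolding packing_set_def corrects_adjacent_transposition_def
    using key unfolding with_proj_simps pverts_transposition_graph subset_iff by meson
qed

lemma A085680_eq_code_size:
  "A085680 m =
     Max (card ` {C. C \<subseteq> weight2_vectors m \<and> corrects_adjacent_transposition C})"
  by (simp add: A085680_def packing_number_def packing_set_transposition_graph_iff)

end

theory Submission
  imports Defs
begin

text \<open>
  A vector with two ones is a cell of the triangle \<open>x, y \<ge> 1\<close>, \<open>x + y \<le> n + 1\<close>, adjacent transpositions are unit steps,
  and a code is a set \<open>S\<close> of cells at mutual \<open>L\<^sub>1\<close>-distance at least three. As unit balls around \<open>S\<close> are disjoint,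
  \<open>5 |S| - n (n + 1) / 2\<close> is the number of covered cells outside the triangle minus the number of uncovered cells
  inside. It suffices to bound this excess by 11, and for that only uncovered cells near the boundary matter. Cut along
  the diagonals \<open>x - y = const\<close>, starting from the two acute corners. Near a corner the maximum is computed column
  by column; from column 15 on the neighbourhoods of the long side and of the leg are separate strips of bounded width,
  where suitable potentials show that the excess does not grow. Both halves meet at the diagonal \<open>x = y\<close>.
  For small \<open>n\<close> the column by column maximum already gives the bound.

  Conversely, the perfect code \<open>x + 2 y \<equiv> c (mod 5)\<close>, modified at the corners of the triangle, attains it.
\<close>

section \<open>Separated sets of cells in a triangle\<close>

definition triangle :: "int \<Rightarrow> (int \<times> int) set" where
  "triangle n = {(x, y). 1 \<le> x \<and> 1 \<le> y \<and> x + y \<le> n + 1}"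

definition separated :: "(int \<times> int) set \<Rightarrow> bool" where
  "separated S \<longleftrightarrow> (\<forall>p\<in>S. \<forall>q\<in>S. p \<noteq> q \<longrightarrow> 3 \<le> \<bar>fst p - fst q\<bar> + \<bar>snd p - snd q\<bar>)"

lemma separatedD:
  "separated S \<Longrightarrow> (x, y) \<in> S \<Longrightarrow> (x', y') \<in> S \<Longrightarrow> x \<noteq> x' \<or> y \<noteq> y' \<Longrightarrow> 3 \<le> \<bar>x - x'\<bar> + \<bar>y - y'\<bar>"
  unfolding separated_def by (metis fst_conv snd_conv)

lemma separatedI:
  "(\<And>x y x' y'. (x, y) \<in> S \<Longrightarrow> (x', y') \<in> S \<Longrightarrow> (x, y) \<noteq> (x', y') \<Longrightarrow> 3 \<le> \<bar>x - x'\<bar> + \<bar>y - y'\<bar>)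
    \<Longrightarrow> separated S"
  unfolding separated_def by (metis prod.collapse)

lemma finite_triangle: "finite (triangle n)"
proof (rule finite_subset)
  show "triangle n \<subseteq> {1..n} \<times> {1..n}" by (auto simp: triangle_def)
qed simp

section \<open>Weight two vectors as cells\<close>

definition two_ones :: "nat \<Rightarrow> nat \<Rightarrow> nat \<Rightarrow> bool list" where
  "two_ones m i j = map (\<lambda>k. k = i \<or> k = j) [0..<m]"

lemma length_two_ones [simp]: "length (two_ones m i j) = m"
  by (simp add: two_ones_def)

lemma nth_two_ones [simp]: "k < m \<Longrightarrow> two_ones m i j ! k \<longleftrightarrow> k = i \<or> k = j"
  by (simp add: two_ones_def)

lemma two_ones_commute: "two_ones m i j = two_ones m j i"
  by (auto simp: two_ones_def)

lemma count_list_True: "count_list u True = card {k. k < length u \<and> u ! k}"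
proof -
  have "count_list u True = length (filter (\<lambda>b. b) u)"
    by (induction u) auto
  then show ?thesis by (simp add: length_filter_conv_card)
qed

lemma two_ones_in_weight2_vectors: "i < j \<Longrightarrow> j < m \<Longrightarrow> two_ones m i j \<in> weight2_vectors m"
proof -
  assume "i < j" "j < m"
  then have "{k. k < m \<and> two_ones m i j ! k} = {i, j}" by auto
  then show ?thesis using \<open>i < j\<close> by (simp add: weight2_vectors_def count_list_True)
qed

lemma weight2_vectorsE:
  assumes "u \<in> weight2_vectors m"
  obtains i j where "i < j" "j < m" "u = two_ones m i j"
proof -
  have len: "length u = m" and "card {k. k < m \<and> u ! k} = 2"
    using assms by (auto simp: weight2_vectors_def count_list_True)
  then obtain a b where ab: "{k. k < m \<and> u ! k} = {a, b}" "a \<noteq> b"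
    by (auto simp: card_2_iff)
  then have lt: "a < m" "b < m" by auto
  have u: "u = two_ones m a b"
    by (rule nth_equalityI) (use len ab(1) in auto)
  show thesis using that[of a b] that[of b a] lt ab(2) u two_ones_commute[of m a b] by (cases "a < b") auto
qed

lemma two_ones_eq_iff:
  assumes "i < j" "j < m" "i' < j'" "j' < m"
  shows "two_ones m i j = two_ones m i' j' \<longleftrightarrow> i = i' \<and> j = j'"
proof
  assume "two_ones m i j = two_ones m i' j'"
  then have "k = i \<or> k = j \<longleftrightarrow> k = i' \<or> k = j'" if "k < m" for k
    using that by (metis nth_two_ones)
  from this[of i] this[of j] this[of i'] this[of j'] show "i = i' \<and> j = j'" using assms by auto
qed auto

lemma swap_adjacent_two_ones:
  assumes "Suc k < m"
  shows "swap_adjacent k (two_ones m i j) =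
    two_ones m (transpose k (Suc k) i) (transpose k (Suc k) j)"
proof (rule nth_equalityI)
  fix l assume "l < length (swap_adjacent k (two_ones m i j))"
  then have "l < m" by simp
  then show "swap_adjacent k (two_ones m i j) ! l = two_ones m (transpose k (Suc k) i) (transpose k (Suc k) j) ! l"
    using assms by (cases "l = k"; cases "l = Suc k")
      (simp_all add: swap_adjacent_def nth_list_update transpose_def)
qed simp

text \<open>A swap moves one of the ones by one position or changes nothing, and every such move
  that keeps the ones distinct is a swap.\<close>

lemma received_words_two_ones:
  assumes "i < j" "j < m"
  shows "w \<in> received_words (two_ones m i j) \<longleftrightarrow>
    (\<exists>i' j'. i' < j' \<and> j' < m \<and> \<bar>int i - int i'\<bar> + \<bar>int j - int j'\<bar> \<le> 1 \<and> w = two_ones m i' j')"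
proof
  assume "w \<in> received_words (two_ones m i j)"
  then consider "w = two_ones m i j" | k where "Suc k < m" "w = swap_adjacent k (two_ones m i j)"
    by (auto simp: received_words_def)
  then show "\<exists>i' j'. i' < j' \<and> j' < m \<and> \<bar>int i - int i'\<bar> + \<bar>int j - int j'\<bar> \<le> 1 \<and> w = two_ones m i' j'"
  proof cases
    case 1
    then show ?thesis using assms by force
  next
    case 2
    show ?thesis
    proof (cases "k = i \<and> Suc k = j")
      case True
      \<comment> \<open>Two neighbouring ones change places, which is invisible in the
        vector.\<close>
      then have "w = two_ones m j i" using 2 by (auto simp: swap_adjacent_two_ones)
      then have "w = two_ones m i j" by (simp only: two_ones_commute)
      then show ?thesis using assms by force
    next
      case False
      then show ?thesis
        using 2 assms
        by (intro exI[of _ "transpose k (Suc k) i"] exI[of _ "transpose k (Suc k) j"])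
          (auto simp: swap_adjacent_two_ones transpose_def)
    qed
  qed
next
  assume "\<exists>i' j'. i' < j' \<and> j' < m \<and> \<bar>int i - int i'\<bar> + \<bar>int j - int j'\<bar> \<le> 1 \<and> w = two_ones m i' j'"
  then obtain i' j' where w: "i' < j'" "j' < m" "\<bar>int i - int i'\<bar> + \<bar>int j - int j'\<bar> \<le> 1" "w = two_ones m i' j'"
    by auto
  have swap: "swap_adjacent k (two_ones m i j) \<in> received_words (two_ones m i j)" if "Suc k < m" for k
    using that by (auto simp: received_words_def)
  consider "i' = i" "j' = j" | "i' = Suc i" "j' = j" | "i = Suc i'" "j' = j" | "i' = i" "j' = Suc j"
    | "i' = i" "j = Suc j'" using w(3) by linarith
  then show "w \<in> received_words (two_ones m i j)"
  proof cases
    case 1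
    then show ?thesis using w by (simp add: received_words_def)
  next
    case 2
    then show ?thesis using w swap[of i] assms by (simp add: swap_adjacent_two_ones transpose_def)
  next
    case 3
    then show ?thesis using w swap[of i'] assms by (simp add: swap_adjacent_two_ones transpose_def)
  next
    case 4
    then show ?thesis using w swap[of j] assms by (simp add: swap_adjacent_two_ones transpose_def)
  next
    case 5
    then show ?thesis using w swap[of j'] assms by (simp add: swap_adjacent_two_ones transpose_def)
  qed
qed

text \<open>Cells at distance at most two have a common neighbour or are neighbours; the point is to
  find the common cell inside the region \<open>a < b\<close>.\<close>

lemma received_words_disjoint_iff:
  assumes "i < j" "j < m" "i' < j'" "j' < m"
  shows "received_words (two_ones m i j) \<inter> received_words (two_ones m i' j') = {} \<longleftrightarrow>
    3 \<le> \<bar>int i - int i'\<bar> + \<bar>int j - int j'\<bar>"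
proof
  assume disjoint: "received_words (two_ones m i j) \<inter> received_words (two_ones m i' j') = {}"
  have False if near: "\<bar>int i - int i'\<bar> + \<bar>int j - int j'\<bar> \<le> 2"
  proof -
    have "\<exists>a b. a < b \<and> b < m \<and> \<bar>int i - int a\<bar> + \<bar>int j - int b\<bar> \<le> 1 \<and>
      \<bar>int i' - int a\<bar> + \<bar>int j' - int b\<bar> \<le> 1"
    proof -
      \<comment> \<open>If a coordinate agrees, take the midpoint in the other one. Otherwise the
        cells are opposite corners of a unit square, and the free corner with the smaller first
        coordinate satisfies \<open>a < b\<close>.\<close>
      consider "i = i'" | "j = j'" | "i < i'" "j \<noteq> j'" | "i' < i" "j \<noteq> j'" by fastforce
      then show ?thesis
      proof cases
        case 1
        define b where "b = (j + j') div 2"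
        have "2 * b \<le> j + j'" "j + j' \<le> 2 * b + 1" unfolding b_def by linarith+
        then have "i < b" "b < m" "\<bar>int j - int b\<bar> \<le> 1" "\<bar>int j' - int b\<bar> \<le> 1"
          using 1 assms near by linarith+
        then show ?thesis using 1 by (intro exI[of _ i] exI[of _ b]) simp
      next
        case 2
        define a where "a = (i + i') div 2"
        have "2 * a \<le> i + i'" "i + i' \<le> 2 * a + 1" unfolding a_def by linarith+
        then have "a < j" "\<bar>int i - int a\<bar> \<le> 1" "\<bar>int i' - int a\<bar> \<le> 1"
          using 2 assms near by linarith+
        then show ?thesis using 2 assms by (intro exI[of _ a] exI[of _ j]) simp
      next
        case 3
        then show ?thesis using assms near by (intro exI[of _ i] exI[of _ j']) auto
      next
        case 4
        then show ?thesis using assms near by (intro exI[of _ i'] exI[of _ j]) auto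
      qed
    qed
    then show False
      using disjoint received_words_two_ones[OF assms(1,2)] received_words_two_ones[OF assms(3,4)] by blast
  qed
  then show "3 \<le> \<bar>int i - int i'\<bar> + \<bar>int j - int j'\<bar>" by fastforce
next
  assume far: "3 \<le> \<bar>int i - int i'\<bar> + \<bar>int j - int j'\<bar>"
  show "received_words (two_ones m i j) \<inter> received_words (two_ones m i' j') = {}"
  proof (rule ccontr)
    assume "\<not> ?thesis"
    then obtain w where w: "w \<in> received_words (two_ones m i j)" "w \<in> received_words (two_ones m i' j')"
      by blast
    obtain a b where ab: "a < b" "b < m" "\<bar>int i - int a\<bar> + \<bar>int j - int b\<bar> \<le> 1" "w = two_ones m a b"
      using w(1) received_words_two_ones[OF assms(1,2)] by auto
    obtain a' b' where ab': "a' < b'" "b' < m" "\<bar>int i' - int a'\<bar> + \<bar>int j' - int b'\<bar> \<le> 1" "w = two_ones m a' b'"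
      using w(2) received_words_two_ones[OF assms(3,4)] by auto
    have "a = a'" "b = b'" using ab ab' two_ones_eq_iff by blast+
    then show False using far ab(3) ab'(3) by linarith
  qed
qed

text \<open>The cell \<open>(x, y)\<close> stands for the vector with ones at (0-based) positions \<open>x - 1\<close> and \<open>m - y\<close>.\<close>

definition vector_of :: "nat \<Rightarrow> int \<times> int \<Rightarrow> bool list" where
  "vector_of m = (\<lambda>(x, y). two_ones m (nat (x - 1)) (m - nat y))"

lemma triangleE:
  assumes "p \<in> triangle (int n)"
  obtains i j where "i < j" "j < n + 1" "p = (int i + 1, int (n + 1 - j))"
proof -
  obtain x y where p: "p = (x, y)" "1 \<le> x" "1 \<le> y" "x + y \<le> int n + 1"
    using assms by (auto simp: triangle_def)
  show thesis
  proof (rule that[of "nat (x - 1)" "n + 1 - nat y"])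
    show "nat (x - 1) < n + 1 - nat y" "n + 1 - nat y < n + 1" using p by linarith+
    show "p = (int (nat (x - 1)) + 1, int (n + 1 - (n + 1 - nat y)))" using p by (simp; linarith)
  qed
qed

lemma vector_of_position: "j < m \<Longrightarrow> vector_of m (int i + 1, int (m - j)) = two_ones m i j"
  by (simp only: vector_of_def) (simp del: of_nat_diff)

lemma bij_betw_vector_of: "bij_betw (vector_of (n + 1)) (triangle (int n)) (weight2_vectors (n + 1))"
  unfolding bij_betw_def
proof (intro conjI equalityI subsetI)
  show "inj_on (vector_of (n + 1)) (triangle (int n))"
  proof (rule inj_onI)
    fix p q assume pq: "p \<in> triangle (int n)" "q \<in> triangle (int n)" "vector_of (n + 1) p = vector_of (n + 1) q"
    obtain i j where p: "i < j" "j < n + 1" "p = (int i + 1, int (n + 1 - j))" using pq(1) by (rule triangleE)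
    obtain i' j' where q: "i' < j'" "j' < n + 1" "q = (int i' + 1, int (n + 1 - j'))" using pq(2) by (rule triangleE)
    have "two_ones (n + 1) i j = two_ones (n + 1) i' j'"
      using pq(3) unfolding p(3) q(3) vector_of_position[OF p(2)] vector_of_position[OF q(2)] .
    then show "p = q" using two_ones_eq_iff[of i j "n + 1" i' j'] p q by simp
  qed
next
  fix u assume "u \<in> vector_of (n + 1) ` triangle (int n)"
  then obtain p where p: "u = vector_of (n + 1) p" "p \<in> triangle (int n)" by blast
  obtain i j where "i < j" "j < n + 1" "p = (int i + 1, int (n + 1 - j))" using p(2) by (rule triangleE)
  then show "u \<in> weight2_vectors (n + 1)"
    unfolding p(1) by (metis vector_of_position two_ones_in_weight2_vectors)
next
  fix u assume "u \<in> weight2_vectors (n + 1)"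
  then obtain i j where "i < j" "j < n + 1" "u = two_ones (n + 1) i j" by (elim weight2_vectorsE)
  moreover from this have "(int i + 1, int (n + 1 - j)) \<in> triangle (int n)" by (auto simp: triangle_def)
  ultimately show "u \<in> vector_of (n + 1) ` triangle (int n)"
    by (metis vector_of_position image_eqI)
qed

lemma corrects_vector_of_iff:
  assumes "S \<subseteq> triangle (int n)"
  shows "corrects_adjacent_transposition (vector_of (n + 1) ` S) \<longleftrightarrow> separated S"
proof -
  have inj: "vector_of (n + 1) p = vector_of (n + 1) q \<longleftrightarrow> p = q" if "p \<in> S" "q \<in> S" for p q
    using that bij_betw_vector_of[of n] assms by (meson bij_betw_def inj_on_eq_iff subsetD)
  have "received_words (vector_of (n + 1) p) \<inter> received_words (vector_of (n + 1) q) = {} \<longleftrightarrow>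
      3 \<le> \<bar>fst p - fst q\<bar> + \<bar>snd p - snd q\<bar>" if pq: "p \<in> S" "q \<in> S" for p q
  proof -
    obtain i j where p: "i < j" "j < n + 1" "p = (int i + 1, int (n + 1 - j))"
      using subsetD[OF assms pq(1)] by (rule triangleE)
    obtain i' j' where q: "i' < j'" "j' < n + 1" "q = (int i' + 1, int (n + 1 - j'))"
      using subsetD[OF assms pq(2)] by (rule triangleE)
    have "\<bar>fst p - fst q\<bar> + \<bar>snd p - snd q\<bar> = \<bar>int i - int i'\<bar> + \<bar>int j - int j'\<bar>"
      using p q by auto
    then show ?thesis
      using received_words_disjoint_iff[OF p(1,2) q(1,2)]
      unfolding p(3) q(3) vector_of_position[OF p(2)] vector_of_position[OF q(2)] by simp
  qed
  with inj show ?thesis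
    unfolding corrects_adjacent_transposition_def separated_def ball_simps by (simp cong: ball_cong)
qed

lemma A085680_eq:
  assumes upper: "\<And>S. S \<subseteq> triangle (int n) \<Longrightarrow> separated S \<Longrightarrow> card S \<le> b"
    and lower: "\<exists>S. S \<subseteq> triangle (int n) \<and> separated S \<and> b \<le> card S"
  shows "A085680 (n + 1) = b"
  unfolding A085680_eq_code_size
proof (rule Max_eqI)
  let ?v = "vector_of (n + 1)"
  have "{C. C \<subseteq> weight2_vectors (n + 1) \<and> corrects_adjacent_transposition C} \<subseteq> Pow (weight2_vectors (n + 1))"
    by auto
  then show "finite (card ` {C. C \<subseteq> weight2_vectors (n + 1) \<and> corrects_adjacent_transposition C})"
    using finite_weight2_vectors finite_subset by blast
  have card: "card (?v ` S) = card S" if "S \<subseteq> triangle (int n)" for S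
    using that bij_betw_vector_of[of n] by (meson bij_betw_def card_image inj_on_subset)
  show "k \<le> b" if "k \<in> card ` {C. C \<subseteq> weight2_vectors (n + 1) \<and> corrects_adjacent_transposition C}" for k
  proof -
    obtain C where C: "C \<subseteq> weight2_vectors (n + 1)" "corrects_adjacent_transposition C" "k = card C"
      using \<open>k \<in> _\<close> by blast
    then obtain S where "S \<subseteq> triangle (int n)" "C = ?v ` S"
      using bij_betw_vector_of[of n] by (metis bij_betw_def subset_imageE)
    then show ?thesis using C upper corrects_vector_of_iff card by simp
  qed
  obtain S where S: "S \<subseteq> triangle (int n)" "separated S" "b \<le> card S" using lower by auto
  then have "card S = b" using upper by (simp add: le_antisym)
  moreover have "?v ` S \<subseteq> weight2_vectors (n + 1)"
    using S(1) bij_betw_vector_of[of n] by (auto simp: bij_betw_def)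
  ultimately show "b \<in> card ` {C. C \<subseteq> weight2_vectors (n + 1) \<and> corrects_adjacent_transposition C}"
    using S corrects_vector_of_iff card by (intro image_eqI[of _ _ "?v ` S"]) auto
qed

section \<open>Column tables and potentials\<close>

text \<open>Computed directly in \<open>int\<close>, so that the evaluations by
  \<open>code_simp\<close> need no conversion from \<open>nat\<close>.\<close>

fun size_int :: "'a list \<Rightarrow> int" where
  "size_int [] = 0"
| "size_int (x # xs) = 1 + size_int xs"

text \<open>
  A column is the increasing list of the heights \<open>y\<close> of its points. With \<open>k = n - (x - y)\<close>, the cells of
  column \<open>k\<close> have \<open>1 \<le> y\<close> and \<open>2 * y \<le> k + 1\<close>; their distance to the long side \<open>x + y = n + 1\<close> is
  \<open>d = k + 1 - 2 * y\<close>. In the coordinates \<open>(k, y)\<close>, distance at least three becomes the compatibility conditions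
  below, \<open>compat_mirror\<close> relating the two columns next to the middle column \<open>x = y\<close>.
\<close>

definition columns :: "int \<Rightarrow> int list list" where
  "columns l = filter (sorted_wrt (\<lambda>a b. a + 2 \<le> b)) (subseqs [1..l])"

definition compat1 :: "int list \<Rightarrow> int list \<Rightarrow> bool" where
  "compat1 A B \<longleftrightarrow> list_all (\<lambda>a. list_all (\<lambda>b. b \<noteq> a \<and> b \<noteq> a + 1) B) A"

definition compat2 :: "int list \<Rightarrow> int list \<Rightarrow> bool" where
  "compat2 A B \<longleftrightarrow> list_all (\<lambda>a. list_all (\<lambda>b. b \<noteq> a \<and> b \<noteq> a + 1 \<and> b \<noteq> a + 2) B) A"

definition compat_mirror :: "int list \<Rightarrow> int list \<Rightarrow> bool" where
  "compat_mirror A B \<longleftrightarrow> list_all (\<lambda>a. list_all (\<lambda>b. b \<noteq> a \<and> b \<noteq> a + 1 \<and> b \<noteq> a - 1) B) A"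

text \<open>
  Maps a column \<open>k\<close> to pairs of a column \<open>k - 1\<close> and the maximal number of points in the columns up to \<open>k\<close>.
\<close>

type_synonym column_table = "(int list \<times> (int list \<times> int) list) list"

text \<open>A running maximum; comparing \<open>c\<close> with \<open>m\<close> first avoids
  compatibility tests that cannot raise it.\<close>

fun best_extension :: "int list \<Rightarrow> (int list \<times> int) list \<Rightarrow> int \<Rightarrow> int" where
  "best_extension C [] m = m"
| "best_extension C ((A, c) # t) m = best_extension C t (if c \<le> m then m else if compat2 A C then c else m)"

fun extend_row :: "int list \<Rightarrow> int \<Rightarrow> column_table \<Rightarrow> (int list \<times> int) list" where
  "extend_row C m [] = []"
| "extend_row C m ((B, t) # F) =
     (if compat1 B C then (B, m + best_extension C t 0) # extend_row C m F else extend_row C m F)"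

definition extend :: "int \<Rightarrow> column_table \<Rightarrow> column_table" where
  "extend l F = map (\<lambda>C. (C, extend_row C (size_int C) F)) (columns l)"

text \<open>
  A feasible dual solution of the longest path problem along the two kinds of sides: whenever a window is moved by
  one column, its weight is at most the increase of the potential. The values were found by an integer programming
  search; the Boolean is the parity of the column index, which decides which distances \<open>d\<close> occur.
\<close>

definition top_potential :: "bool \<Rightarrow> int list \<Rightarrow> int list \<Rightarrow> int" where
  "top_potential p A B =
    (if p then
       (if (A, B) \<in> set [([], [6]), ([5], []), ([3], [0]), ([1], [4]), ([], [0, 6]), ([1, 5], [])] then 5
        else if (A, B) = ([3], [6]) then 7 else 6)
     else
       (if (A, B) \<in> set [([6], []), ([], [5]), ([4], [1]), ([0], [3]), ([0, 6], []), ([], [1, 5])] then 6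
        else if (A, B) = ([6], [3]) then 4 else 5))"

definition bottom_potential :: "int list \<Rightarrow> int list \<Rightarrow> int" where
  "bottom_potential A B =
    (if (A, B) \<in> set [([], [1, 5]), ([2], [1, 4]), ([4], [1, 3]), ([1, 4], [6]), ([2, 5], [1]),
        ([6], [1, 5]), ([], [1, 3, 5]), ([2], [1, 4, 6]), ([4], [1, 3, 6]), ([6], [1, 3, 5]),
        ([2, 6], [1, 4]), ([4, 6], [1, 3])] then 1
     else if (A, B) \<in> set [([], [5]), ([4], []), ([2], [4]), ([3], [2]), ([4], [3]), ([4], [6]),
        ([6], [5]), ([], [2, 5]), ([2, 4], []), ([4, 6], []), ([2, 4], [6]), ([5], [1, 4]),
        ([2, 5], [4]), ([3, 5], [2]), ([6], [2, 5]), ([4, 6], [3]), ([2, 4, 6], [])] then - 1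
     else 0)"

text \<open>This and the next two functions test \<open>c + d - size_int A \<le> m\<close> for all
  mirror-compatible pairs of entries under the same middle column \<open>A\<close>, whose points are
  counted in both totals.\<close>

fun joinable_with :: "int list \<Rightarrow> int \<Rightarrow> (int list \<times> int) list \<Rightarrow> bool" where
  "joinable_with P m [] = True"
| "joinable_with P m ((Q, d) # t) =
     (if d \<le> m then joinable_with P m t else if compat_mirror P Q then False else joinable_with P m t)"

fun joinable_row :: "int \<Rightarrow> (int list \<times> int) list \<Rightarrow> (int list \<times> int) list \<Rightarrow> bool" where
  "joinable_row m [] u = True"
| "joinable_row m ((P, c) # t) u =
     (if joinable_with P (m - c) u then joinable_row m t u else False)"

fun joinable :: "int \<Rightarrow> column_table \<Rightarrow> bool" where
  "joinable m [] = True"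
| "joinable m ((A, t) # F) = (if joinable_row (m + size_int A) t t then joinable m F else False)"

text \<open>Distances to the long side decrease with the height; \<open>rev\<close> restores the
  increasing order, since the potentials compare lists literally.\<close>

definition crop_top :: "int \<Rightarrow> int list \<Rightarrow> int list" where
  "crop_top k A = rev (map (\<lambda>y. k + 1 - 2 * y) (filter (\<lambda>y. k + 1 - 2 * y \<le> 6) A))"

definition crop_bottom :: "int list \<Rightarrow> int list" where
  "crop_bottom A = filter (\<lambda>y. y \<le> 6) A"

text \<open>
  The left-hand side is the excess of the columns before column 15, which have 56 cells: unit balls around points of
  columns 14 and 15 have two and three cells in later columns.
\<close>

definition dominated :: "column_table \<Rightarrow> bool" where
  "dominated F \<longleftrightarrow> list_all (\<lambda>(B, t). list_all (\<lambda>(A, c).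
      5 * c - 2 * size_int A - 3 * size_int B - 56
        \<le> top_potential True (crop_top 14 A) (crop_top 15 B)
          + bottom_potential (crop_bottom A) (crop_bottom B)) t) F"

text \<open>The table of column \<open>k\<close> is joined with itself to settle the triangle of
  size \<open>k\<close>; the bound is claimed only from 6 on. The table left at the end has to lie
  below the potentials.\<close>

fun verify :: "nat \<Rightarrow> int \<Rightarrow> column_table \<Rightarrow> bool" where
  "verify 0 k F = dominated F"
| "verify (Suc i) k F =
    (if k < 6 \<or> joinable (k * (k + 1) div 10 + 2) F then verify i (k + 1) (extend ((k + 2) div 2) F) else False)"

text \<open>Column 0 is empty and column 1 is the single corner cell of height 1.\<close>

definition initial_table :: column_table where
  "initial_table = [([], [([], 0)]), ([1], [([], 1)])]"

text \<open>Fourteen steps lead from column 1 to column 15 and check the sizes 6 to 14 on the way.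
  The unary numeral fits the recursion of \<open>verify\<close>.\<close>

lemma verify_initial_table:
  "verify (Suc (Suc (Suc (Suc (Suc (Suc (Suc (Suc (Suc (Suc (Suc (Suc (Suc (Suc 0)))))))))))))) 1 initial_table"
  by code_simp

section \<open>Local weights along the sides and the finite checks of the potentials\<close>

definition mem_ind :: "int list \<Rightarrow> int \<Rightarrow> int" where
  "mem_ind A y = (if y \<in> set A then 1 else 0)"

text \<open>Height 0 lies outside the triangle and heights 1 to 5 inside, hence the subtracted 5.
  The windows \<open>A\<close>, \<open>B\<close>, \<open>C\<close> belong to three consecutive
  columns.\<close>

definition bottom_weight :: "int list \<Rightarrow> int list \<Rightarrow> int list \<Rightarrow> int" where
  "bottom_weight A B C = sum_list (map (\<lambda>y. mem_ind B y + mem_ind A y + mem_ind A (y - 1) + mem_ind C y + mem_ind C (y + 1)) [0, 1, 2, 3, 4, 5]) - 5"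

text \<open>On the middle diagonal the cell of height 0 has no neighbour in the triangle, so the sum
  starts at 1. \<open>A\<close> and \<open>C\<close> are the adjacent columns of the two halves and
  enter symmetrically.\<close>

definition mirror_weight :: "int list \<Rightarrow> int list \<Rightarrow> int list \<Rightarrow> int" where
  "mirror_weight A B C = sum_list (map (\<lambda>y. mem_ind B y + mem_ind A y + mem_ind A (y - 1) + mem_ind C y + mem_ind C (y - 1)) [1, 2, 3, 4, 5]) - 5"

text \<open>In column \<open>k\<close> the distance \<open>d = k + 1 - 2 * y\<close> is even iff
  \<open>k\<close> is odd. Both parities have three cells inside the triangle; only
  \<open>d = - 1\<close> lies outside.\<close>

definition top_cells :: "bool \<Rightarrow> int list" where
  "top_cells p = (if p then [0, 2, 4] else [- 1, 1, 3, 5])"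

definition top_weight :: "bool \<Rightarrow> int list \<Rightarrow> int list \<Rightarrow> int list \<Rightarrow> int" where
  "top_weight p A B C = sum_list (map (\<lambda>d. mem_ind B d + mem_ind A (d - 1) + mem_ind A (d + 1) + mem_ind C (d - 1) + mem_ind C (d + 1)) (top_cells p)) - 3"

definition top_columns :: "bool \<Rightarrow> int list list" where
  "top_columns p = filter (sorted_wrt (\<lambda>a b. a + 4 \<le> b)) (subseqs (if p then [0, 2, 4, 6] else [1, 3, 5]))"

text \<open>In the coordinates \<open>(k, d)\<close> the distance is the maximum of the two
  differences, so cells one or two columns apart must differ by 3 in \<open>d\<close>. Within a
  column parity raises this to 4, as in \<open>top_columns\<close>.\<close>

definition compat_top :: "int list \<Rightarrow> int list \<Rightarrow> bool" where
  "compat_top A B \<longleftrightarrow> list_all (\<lambda>a. list_all (\<lambda>b. a + 3 \<le> b \<or> b + 3 \<le> a) B) A"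

lemma bottom_check:
  "list_all (\<lambda>A. list_all (\<lambda>B. compat1 A B \<longrightarrow> list_all (\<lambda>C. compat1 B C \<and> compat2 A C \<longrightarrow>
     bottom_weight A B C + bottom_potential A B \<le> bottom_potential B C) (columns 6)) (columns 6)) (columns 6)"
  by code_simp

lemma bottom_join_check:
  "list_all (\<lambda>A. list_all (\<lambda>B. compat1 A B \<longrightarrow> list_all (\<lambda>C. compat1 C B \<and> compat_mirror A C \<longrightarrow>
     mirror_weight A B C + bottom_potential A B + bottom_potential C B \<le> 0) (columns 6)) (columns 6)) (columns 6)"
  by code_simp

lemma top_check:
  "list_all (\<lambda>p. list_all (\<lambda>A. list_all (\<lambda>B. compat_top A B \<longrightarrow> list_all (\<lambda>C. compat_top B C \<and> compat_top A C \<longrightarrow>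
     top_weight p A B C + top_potential p A B \<le> top_potential (\<not> p) B C) (top_columns (\<not> p))) (top_columns p)) (top_columns (\<not> p)))
     [True, False]"
  by code_simp

text \<open>The constant 11 of the excess bound arises here; the bottom side contributes 0 by
  \<open>bottom_join_check\<close>.\<close>

lemma top_join_check:
  "list_all (\<lambda>p. list_all (\<lambda>A. list_all (\<lambda>B. compat_top A B \<longrightarrow> list_all (\<lambda>C. compat_top B C \<and> compat_top A C \<longrightarrow>
     top_weight p A B C + top_potential p A B + top_potential p C B \<le> 11) (top_columns (\<not> p))) (top_columns p)) (top_columns (\<not> p)))
     [True, False]"
  by code_simp

section \<open>Soundness of the tables\<close>

lemma size_int_eq: "size_int xs = int (length xs)"
  by (induction xs) auto

lemma best_ge: "m \<le> best_extension C t m"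
proof (induction C t m rule: best_extension.induct)
  case (2 C A c t m)
  have "m \<le> (if c \<le> m then m else if compat2 A C then c else m)" by simp
  with 2 show ?case by simp
qed simp

lemma best_upper: "(A, v) \<in> set t \<Longrightarrow> compat2 A C \<Longrightarrow> v \<le> best_extension C t m"
proof (induction C t m rule: best_extension.induct)
  case (2 C A' c t m)
  then show ?case
    using best_ge[of m C t] best_ge[of c C t] by (auto split: if_splits)
qed simp

lemma extend_row_mem:
  "(B, t) \<in> set F \<Longrightarrow> compat1 B C \<Longrightarrow> (B, m + best_extension C t 0) \<in> set (extend_row C m F)"
  by (induction C m F rule: extend_row.induct) auto

lemma map_of_extend:
  "C \<in> set (columns l) \<Longrightarrow> map_of (extend l F) C = Some (extend_row C (size_int C) F)"
  unfolding extend_def by (simp add: map_of_map_restrict)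

lemma joinable_withD:
  "joinable_with P m t \<Longrightarrow> (Q, d) \<in> set t \<Longrightarrow> compat_mirror P Q \<Longrightarrow> d \<le> m"
  by (induction P m t rule: joinable_with.induct) (auto split: if_splits)

lemma joinable_rowD:
  "joinable_row m t u \<Longrightarrow> (P, c) \<in> set t \<Longrightarrow> joinable_with P (m - c) u"
  by (induction m t u rule: joinable_row.induct) (auto split: if_splits)

lemma joinableD:
  "joinable m F \<Longrightarrow> (A, t) \<in> set F \<Longrightarrow> joinable_row (m + size_int A) t t"
  by (induction m F rule: joinable.induct) (auto split: if_splits)

definition column :: "(int \<Rightarrow> int \<Rightarrow> bool) \<Rightarrow> int \<Rightarrow> int list" where
  "column c k = filter (c k) [1..(k + 1) div 2]"

definition points_upto :: "(int \<Rightarrow> int \<Rightarrow> bool) \<Rightarrow> int \<Rightarrow> int" where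
  "points_upto c k = (\<Sum>i=1..k. size_int (column c i))"

text \<open>Using \<open>map_of\<close> rather than membership puts two half packings with the same
  last column into the same row list, which is what \<open>joinable\<close> compares with
  itself.\<close>

definition tabulated :: "(int \<Rightarrow> int \<Rightarrow> bool) \<Rightarrow> int \<Rightarrow> column_table \<Rightarrow> bool" where
  "tabulated c k F \<longleftrightarrow> (\<exists>t v. map_of F (column c k) = Some t \<and>
     (column c (k - 1), v) \<in> set t \<and> points_upto c k \<le> v)"

lemma total_step: "k \<ge> 0 \<Longrightarrow> points_upto c (k + 1) = points_upto c k + size_int (column c (k + 1))"
proof -
  assume "k \<ge> 0"
  then have "{1..k + 1} = insert (k + 1) {1..k}" by auto
  then show ?thesis by (simp add: points_upto_def)
qed

lemma filter_mem_subseqs: "filter P xs \<in> set (subseqs xs)"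
  by (induction xs) (auto simp: Let_def)

lemma sum_indicator_column:
  assumes "a \<le> 1" "(k + 1) div 2 \<le> b" "\<And>y. c k y \<Longrightarrow> 1 \<le> y \<and> 2 * y \<le> k + 1"
  shows "(\<Sum>y=a..b. of_bool (c k y)) = size_int (column c k)"
proof -
  have "(\<Sum>y=a..b. of_bool (c k y)) = (\<Sum>y\<in>{1..(k + 1) div 2}. of_bool (c k y) :: int)"
    by (rule sum.mono_neutral_right) (use assms in force)+
  also have "\<dots> = int (card ({1..(k + 1) div 2} \<inter> {y. c k y}))"
    by (subst sum_of_bool_eq) simp_all
  also have "{1..(k + 1) div 2} \<inter> {y. c k y} = set (column c k)"
    by (auto simp: column_def)
  also have "int (card (set (column c k))) = size_int (column c k)"
    by (simp only: size_int_eq, subst distinct_card) (simp_all add: column_def)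
  finally show ?thesis .
qed

text \<open>One half of a separated set in the coordinates \<open>(k, y)\<close>. Columns at least
  three apart impose no condition, as the distance is at least the difference of the column
  indices.\<close>

locale half_packing =
  fixes c :: "int \<Rightarrow> int \<Rightarrow> bool"
  assumes range: "c k y \<Longrightarrow> 1 \<le> y \<and> 2 * y \<le> k + 1"
    and same: "c k y \<Longrightarrow> c k y' \<Longrightarrow> y < y' \<Longrightarrow> y + 2 \<le> y'"
    and adjacent: "c k y \<Longrightarrow> c (k + 1) y' \<Longrightarrow> y' \<noteq> y \<and> y' \<noteq> y + 1"
    and second: "c k y \<Longrightarrow> c (k + 2) y' \<Longrightarrow> y' \<noteq> y \<and> y' \<noteq> y + 1 \<and> y' \<noteq> y + 2"
begin

lemma filter_mem_columns: "filter (c k) [1..l] \<in> set (columns l)"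
proof -
  have "sorted_wrt (<) (filter (c k) [1..l])"
    by (rule sorted_wrt_filter) simp
  then have "sorted_wrt (\<lambda>a b. a + 2 \<le> b) (filter (c k) [1..l])"
    by (rule sorted_wrt_mono_rel[rotated]) (auto intro: same)
  then show ?thesis
    by (simp add: columns_def filter_mem_subseqs)
qed

lemma column_mem_columns: "column c k \<in> set (columns ((k + 1) div 2))"
  unfolding column_def by (rule filter_mem_columns)

lemma set_column: "set (column c k) = {y. c k y}"
  using range by (force simp: column_def)

lemma compat1_column: "compat1 (column c k) (column c (k + 1))"
  using adjacent by (simp add: compat1_def list_all_iff set_column)

lemma compat2_column: "compat2 (column c k) (column c (k + 2))"
  using second by (simp add: compat2_def list_all_iff set_column)

lemma tabulated_extend:
  assumes "tabulated c k F" "k \<ge> 0"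
  shows "tabulated c (k + 1) (extend ((k + 2) div 2) F)"
proof -
  obtain t v where t: "map_of F (column c k) = Some t" "(column c (k - 1), v) \<in> set t" "points_upto c k \<le> v"
    using assms(1) by (auto simp: tabulated_def)
  let ?C = "column c (k + 1)"
  have "map_of (extend ((k + 2) div 2) F) ?C = Some (extend_row ?C (size_int ?C) F)"
    by (rule map_of_extend) (use column_mem_columns[of "k + 1"] in simp)
  moreover have "(column c k, size_int ?C + best_extension ?C t 0) \<in> set (extend_row ?C (size_int ?C) F)"
    using map_of_SomeD[OF t(1)] compat1_column by (rule extend_row_mem)
  moreover have "v \<le> best_extension ?C t 0"
    using t(2) compat2_column[of "k - 1"] by (intro best_upper) (simp_all add: add.commute)
  ultimately show ?thesis
    using t(3) assms(2) by (auto simp: tabulated_def total_step)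
qed

lemma tabulated_initial: "tabulated c 1 initial_table"
proof -
  have "column c 0 = []" by (simp add: column_def)
  moreover have "column c 1 = (if c 1 1 then [1] else [])" by (simp add: column_def)
  ultimately show ?thesis
    by (auto simp: tabulated_def initial_table_def points_upto_def)
qed

end

text \<open>The table \<open>G\<close> is chosen before \<open>c\<close>, so that both halves of a
  packing can be looked up in the same table.\<close>

lemma verify_joinable:
  assumes "verify i k F" "k \<ge> 0" "6 \<le> n" "k \<le> n" "n < k + int i"
  shows "\<exists>G. joinable (n * (n + 1) div 10 + 2) G \<and>
    (\<forall>c. half_packing c \<longrightarrow> tabulated c k F \<longrightarrow> tabulated c n G)"
  using assms
proof (induction i k F rule: verify.induct)
  case (2 i k F)
  show ?case
  proof (cases "k = n")
    case True
    then show ?thesis using 2 by (auto split: if_splits)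
  next
    case False
    then obtain G where "joinable (n * (n + 1) div 10 + 2) G"
      "\<forall>c. half_packing c \<longrightarrow> tabulated c (k + 1) (extend ((k + 2) div 2) F) \<longrightarrow> tabulated c n G"
      using 2 by (auto split: if_splits)
    then show ?thesis using half_packing.tabulated_extend 2 by blast
  qed
qed simp

lemma verify_dominated:
  assumes "verify i k F" "k \<ge> 0"
  shows "\<exists>G. dominated G \<and>
    (\<forall>c. half_packing c \<longrightarrow> tabulated c k F \<longrightarrow> tabulated c (k + int i) G)"
  using assms
proof (induction i k F rule: verify.induct)
  case (1 k F)
  then show ?case by auto
next
  case (2 i k F)
  then obtain G where "dominated G"
    "\<forall>c. half_packing c \<longrightarrow> tabulated c (k + 1) (extend ((k + 2) div 2) F) \<longrightarrow> tabulated c (k + 1 + int i) G"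
    by (auto split: if_splits)
  then show ?case using half_packing.tabulated_extend 2(3) by (metis add.assoc add.commute of_nat_Suc)
qed

section \<open>Sliding windows along the sides\<close>

definition lower_window :: "(int \<Rightarrow> int \<Rightarrow> bool) \<Rightarrow> int \<Rightarrow> int list" where
  "lower_window c k = filter (c k) [1..6]"

definition top_layers :: "bool \<Rightarrow> int list" where
  "top_layers p = (if p then [0, 2, 4, 6] else [1, 3, 5])"

text \<open>\<open>top_layers\<close> contains only distances of the parity that occurs in column
  \<open>k\<close>, so the division is exact.\<close>

definition upper_window :: "(int \<Rightarrow> int \<Rightarrow> bool) \<Rightarrow> int \<Rightarrow> int list" where
  "upper_window c k = filter (\<lambda>d. c k ((k + 1 - d) div 2)) (top_layers (odd k))"

definition potential :: "(int \<Rightarrow> int \<Rightarrow> bool) \<Rightarrow> int \<Rightarrow> int" where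
  "potential c k = top_potential (odd k) (upper_window c (k - 1)) (upper_window c k)
     + bottom_potential (lower_window c (k - 1)) (lower_window c k)"

context half_packing
begin

lemma bottom_window_column:
  assumes "k \<ge> 11"
  shows "crop_bottom (column c k) = lower_window c k"
proof -
  have "[1..(k + 1) div 2] = [1..6] @ [6 + 1..(k + 1) div 2]"
    by (rule upto_split2) (use assms in auto)
  moreover have "filter (\<lambda>y. c k y \<and> y \<le> 6) [6 + 1..(k + 1) div 2] = []"
    by (simp add: filter_empty_conv)
  moreover have "filter (\<lambda>y. c k y \<and> y \<le> 6) [1..6] = filter (c k) [1..6]"
    by (rule filter_cong) auto
  ultimately show ?thesis
    by (simp add: crop_bottom_def lower_window_def column_def conj_commute)
qed

lemma top_window_column_14: "crop_top 14 (column c 14) = upper_window c 14"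
proof -
  have "[1..(14 + 1) div 2] = [1, 2, 3, 4, 5, 6, 7 :: int]" by (simp add: upto.simps)
  then show ?thesis by (simp add: crop_top_def upper_window_def top_layers_def column_def)
qed

lemma top_window_column_15: "crop_top 15 (column c 15) = upper_window c 15"
proof -
  have "[1..(15 + 1) div 2] = [1, 2, 3, 4, 5, 6, 7, 8 :: int]" by (simp add: upto.simps)
  then show ?thesis by (simp add: crop_top_def upper_window_def top_layers_def column_def)
qed

text \<open>The base of the induction along the columns, read off the last table of
  \<open>verify\<close>.\<close>

lemma potential_15:
  "5 * points_upto c 15 - 2 * size_int (column c 14) - 3 * size_int (column c 15) - 56 \<le> potential c 15"
proof -
  obtain G where "dominated G" "tabulated c 15 G"
    using verify_dominated[OF verify_initial_table] tabulated_initial half_packing_axioms by auto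
  then show ?thesis
    by (fastforce simp: tabulated_def dominated_def list_all_iff potential_def
        bottom_window_column top_window_column_14 top_window_column_15 dest!: map_of_SomeD)
qed

end

section \<open>Weight of a column against the increase of the potential\<close>

text \<open>The number of points whose unit ball contains the cell of column \<open>k\<close> at height \<open>y\<close>.\<close>

definition coverage :: "(int \<Rightarrow> int \<Rightarrow> bool) \<Rightarrow> int \<Rightarrow> int \<Rightarrow> int" where
  "coverage c k y = of_bool (c k y) + of_bool (c (k - 1) y) + of_bool (c (k - 1) (y - 1))
     + of_bool (c (k + 1) y) + of_bool (c (k + 1) (y + 1))"

lemma sum_shift_int: "(\<Sum>y=a..b. f (y + d)) = (\<Sum>y=a + d..b + d. f y)" for a b d :: int
  by (rule sum.reindex_bij_witness[of _ "\<lambda>y. y - d" "\<lambda>y. y + d"]) auto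

text \<open>Interior cells are bounded by 1 each, covered or not; this discards everything away from
  the two sides.\<close>

lemma sum_split_bound:
  fixes f :: "int \<Rightarrow> int"
  assumes "\<And>y. f y \<le> 1" "a \<le> s" "s \<le> t" "t \<le> b + 1"
  shows "(\<Sum>y=a..b. f y) \<le> (\<Sum>y=a..s - 1. f y) + (t - s) + (\<Sum>y=t..b. f y)"
proof -
  have "{a..b} = {a..s - 1} \<union> ({s..t - 1} \<union> {t..b})" using assms by auto
  moreover have "sum f ({a..s - 1} \<union> ({s..t - 1} \<union> {t..b})) = sum f {a..s - 1} + sum f ({s..t - 1} \<union> {t..b})"
    by (rule sum.union_disjoint) (use assms in auto)
  moreover have "sum f ({s..t - 1} \<union> {t..b}) = sum f {s..t - 1} + sum f {t..b}"
    by (rule sum.union_disjoint) auto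
  moreover have "(\<Sum>y=s..t - 1. f y) \<le> (\<Sum>y=s..t - 1. 1)"
    by (rule sum_mono) (rule assms)
  ultimately show ?thesis using assms by simp
qed

lemma interval_unfold: "a \<le> b \<Longrightarrow> (\<Sum>y=a..b. f y) = f a + (\<Sum>y=a + 1..b. f y)" for a b :: int
  by (subst simp_from_to) auto

lemma top_memD:
  assumes "a \<in> set (upper_window c k)"
  obtains y where "a = k + 1 - 2 * y" "c k y"
proof
  show "c k ((k + 1 - a) div 2)" using assms by (simp add: upper_window_def)
  have "odd k \<longleftrightarrow> even a" using assms by (auto simp: upper_window_def top_layers_def split: if_splits)
  then show "a = k + 1 - 2 * ((k + 1 - a) div 2)" by presburger
qed

lemma top_weight_split:
  "sum_list (map (mem_ind B) (top_cells p)) + sum_list (map (\<lambda>d. mem_ind A (d - 1) + mem_ind A (d + 1)) (top_cells p))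
    + sum_list (map (\<lambda>d. mem_ind C (d - 1) + mem_ind C (d + 1)) (top_cells p)) = top_weight p A B C + 3"
  by (simp add: top_weight_def top_cells_def)

context half_packing
begin

text \<open>Two points whose unit balls share a cell would be at distance at most two.\<close>

lemma coverage_le_1: "coverage c k y \<le> 1"
  using adjacent[of "k - 1" y y] adjacent[of "k - 1" "y - 1" y] adjacent[of k y y] adjacent[of k y "y + 1"]
    same[of "k - 1" "y - 1" y] same[of "k + 1" y "y + 1"] second[of "k - 1" y y]
    second[of "k - 1" y "y + 1"] second[of "k - 1" "y - 1" y] second[of "k - 1" "y - 1" "y + 1"]
  by (auto simp: coverage_def of_bool_def add.commute)

text \<open>The range includes the cells just outside the triangle: height 0, and for even
  \<open>k\<close> also the top height, where \<open>d = - 1\<close>. Thus no contribution of the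
  three columns is lost.\<close>

lemma sum_coverage:
  "(\<Sum>y=0..(k + 2) div 2. coverage c k y) =
     size_int (column c k) + 2 * size_int (column c (k - 1)) + 2 * size_int (column c (k + 1))"
proof -
  let ?M = "(k + 2) div 2"
  have "(\<Sum>y=0..?M. of_bool (c k y)) = size_int (column c k)"
    "(\<Sum>y=0..?M. of_bool (c (k - 1) y)) = size_int (column c (k - 1))"
    "(\<Sum>y=0..?M. of_bool (c (k + 1) y)) = size_int (column c (k + 1))"
    by (rule sum_indicator_column; auto dest: range)+
  moreover have "(\<Sum>y=0..?M. of_bool (c (k - 1) (y - 1))) = size_int (column c (k - 1))"
    unfolding sum_shift_int[of "\<lambda>y. of_bool (c (k - 1) y)" "- 1", simplified]
    by (rule sum_indicator_column) (auto dest: range)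
  moreover have "(\<Sum>y=0..?M. of_bool (c (k + 1) (y + 1))) = size_int (column c (k + 1))"
    unfolding sum_shift_int[of "\<lambda>y. of_bool (c (k + 1) y)" 1]
    by (rule sum_indicator_column) (auto dest: range)
  ultimately show ?thesis
    by (simp add: coverage_def sum.distrib)
qed

lemma ind_bottom: "y \<le> 6 \<Longrightarrow> mem_ind (lower_window c k) y = of_bool (c k y)"
  using range[of k y] by (auto simp: mem_ind_def lower_window_def)

lemma ind_top:
  assumes "k - 5 \<le> 2 * y" "2 * y \<le> k + 3"
  shows "mem_ind (upper_window c k) (k + 1 - 2 * y) = of_bool (c k y)"
proof -
  have "k + 1 - 2 * y \<in> set (top_layers (odd k))" if "c k y"
    using range[OF that] assms by (auto simp: top_layers_def) presburger+
  then show ?thesis by (auto simp: mem_ind_def upper_window_def)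
qed

lemma bottom_mem_columns: "lower_window c k \<in> set (columns 6)"
  unfolding lower_window_def by (rule filter_mem_columns)

lemma top_mem_columns: "upper_window c k \<in> set (top_columns (odd k))"
proof -
  have "sorted_wrt (<) (upper_window c k)"
    unfolding upper_window_def by (rule sorted_wrt_filter) (simp add: top_layers_def)
  then have "sorted_wrt (\<lambda>a b. a + 4 \<le> b) (upper_window c k)"
  proof (rule sorted_wrt_mono_rel[rotated])
    fix a b assume "a \<in> set (upper_window c k)" "b \<in> set (upper_window c k)" "a < b"
    then show "a + 4 \<le> b" by (elim top_memD) (use same in force)
  qed
  then show ?thesis by (simp add: top_columns_def upper_window_def top_layers_def filter_mem_subseqs)
qed

lemma compat_bottom:
  "compat1 (lower_window c k) (lower_window c (k + 1))" "compat2 (lower_window c k) (lower_window c (k + 2))"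
  unfolding compat1_def compat2_def list_all_iff lower_window_def using adjacent second by auto blast+

lemma compat_top_adjacent: "compat_top (upper_window c k) (upper_window c (k + 1))"
  unfolding compat_top_def list_all_iff
  by (intro ballI, elim top_memD) (use adjacent in fastforce)

lemma compat_top_second: "compat_top (upper_window c k) (upper_window c (k + 2))"
  unfolding compat_top_def list_all_iff
  by (intro ballI, elim top_memD) (use second in fastforce)

lemma sum_coverage_bottom:
  "(\<Sum>y=0..5. coverage c k y) = bottom_weight (lower_window c (k - 1)) (lower_window c k) (lower_window c (k + 1)) + 5"
  by (simp add: bottom_weight_def interval_unfold coverage_def ind_bottom)

text \<open>Translates sums over heights into sums over distances \<open>d\<close>. The parities of
  \<open>k\<close> are treated separately, since they involve three and four cells.\<close>

lemma top_sums:
  fixes k :: int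
  defines "I \<equiv> {(k + 1) div 2 - 2..(k + 2) div 2}" and "ds \<equiv> top_cells (odd k)"
  shows top_sum: "(\<Sum>y\<in>I. of_bool (c k y)) = sum_list (map (mem_ind (upper_window c k)) ds)"
    and top_sum_prev: "(\<Sum>y\<in>I. of_bool (c (k - 1) y) + of_bool (c (k - 1) (y - 1))) =
      sum_list (map (\<lambda>d. mem_ind (upper_window c (k - 1)) (d - 1) + mem_ind (upper_window c (k - 1)) (d + 1)) ds)"
    and top_sum_next: "(\<Sum>y\<in>I. of_bool (c (k + 1) y) + of_bool (c (k + 1) (y + 1))) =
      sum_list (map (\<lambda>d. mem_ind (upper_window c (k + 1)) (d - 1) + mem_ind (upper_window c (k + 1)) (d + 1)) ds)"
proof -
  have "(\<Sum>y\<in>I. of_bool (c k y)) = sum_list (map (mem_ind (upper_window c k)) ds) \<and>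
    (\<Sum>y\<in>I. of_bool (c (k - 1) y) + of_bool (c (k - 1) (y - 1))) =
      sum_list (map (\<lambda>d. mem_ind (upper_window c (k - 1)) (d - 1) + mem_ind (upper_window c (k - 1)) (d + 1)) ds) \<and>
    (\<Sum>y\<in>I. of_bool (c (k + 1) y) + of_bool (c (k + 1) (y + 1))) =
      sum_list (map (\<lambda>d. mem_ind (upper_window c (k + 1)) (d - 1) + mem_ind (upper_window c (k + 1)) (d + 1)) ds)"
  proof (cases "odd k")
    case True
    then obtain j where k: "k = 2 * j + 1" by (elim oddE)
    show ?thesis
      using ind_top[of "2 * j + 1" "j - 1"] ind_top[of "2 * j + 1" j] ind_top[of "2 * j + 1" "j + 1"]
        ind_top[of "2 * j" "j - 2"] ind_top[of "2 * j" "j - 1"] ind_top[of "2 * j" j] ind_top[of "2 * j" "j + 1"]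
        ind_top[of "2 + 2 * j" "j - 1"] ind_top[of "2 + 2 * j" j] ind_top[of "2 + 2 * j" "j + 1"]
        ind_top[of "2 + 2 * j" "2 + j"]
      by (simp add: I_def ds_def k interval_unfold top_cells_def add.commute del: sum_of_bool_eq)
  next
    case False
    then have "even k" by simp
    then obtain j where k: "k = 2 * j" by (elim evenE)
    show ?thesis
      using ind_top[of "2 * j" "j - 2"] ind_top[of "2 * j" "j - 1"] ind_top[of "2 * j" j] ind_top[of "2 * j" "j + 1"]
        ind_top[of "2 * j - 1" "j - 3"] ind_top[of "2 * j - 1" "j - 2"] ind_top[of "2 * j - 1" "j - 1"]
        ind_top[of "2 * j - 1" j] ind_top[of "2 * j - 1" "j + 1"]
        ind_top[of "1 + 2 * j" "j - 2"] ind_top[of "1 + 2 * j" "j - 1"] ind_top[of "1 + 2 * j" j]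
        ind_top[of "1 + 2 * j" "j + 1"] ind_top[of "1 + 2 * j" "2 + j"]
      by (simp add: I_def ds_def k interval_unfold top_cells_def add.commute del: sum_of_bool_eq)
  qed
  then show "(\<Sum>y\<in>I. of_bool (c k y)) = sum_list (map (mem_ind (upper_window c k)) ds)"
    "(\<Sum>y\<in>I. of_bool (c (k - 1) y) + of_bool (c (k - 1) (y - 1))) =
      sum_list (map (\<lambda>d. mem_ind (upper_window c (k - 1)) (d - 1) + mem_ind (upper_window c (k - 1)) (d + 1)) ds)"
    "(\<Sum>y\<in>I. of_bool (c (k + 1) y) + of_bool (c (k + 1) (y + 1))) =
      sum_list (map (\<lambda>d. mem_ind (upper_window c (k + 1)) (d - 1) + mem_ind (upper_window c (k + 1)) (d + 1)) ds)"
    by auto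
qed

lemma sum_coverage_top:
  "(\<Sum>y=(k + 1) div 2 - 2..(k + 2) div 2. coverage c k y) =
     top_weight (odd k) (upper_window c (k - 1)) (upper_window c k) (upper_window c (k + 1)) + 3"
proof -
  let ?I = "{(k + 1) div 2 - 2..(k + 2) div 2}"
  have "(\<Sum>y\<in>?I. coverage c k y) = (\<Sum>y\<in>?I. of_bool (c k y))
    + (\<Sum>y\<in>?I. of_bool (c (k - 1) y) + of_bool (c (k - 1) (y - 1)))
    + (\<Sum>y\<in>?I. of_bool (c (k + 1) y) + of_bool (c (k + 1) (y + 1)))"
    by (simp only: coverage_def sum.distrib add.assoc)
  then show ?thesis
    unfolding top_sum top_sum_prev top_sum_next by (simp only: top_weight_split)
qed

lemma column_weight:
  assumes "k \<ge> 15"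
  shows "size_int (column c k) + 2 * size_int (column c (k - 1)) + 2 * size_int (column c (k + 1)) - (k + 1) div 2
    \<le> bottom_weight (lower_window c (k - 1)) (lower_window c k) (lower_window c (k + 1))
      + top_weight (odd k) (upper_window c (k - 1)) (upper_window c k) (upper_window c (k + 1))"
proof -
  \<comment> \<open>This is where 15 comes from: it is the first column in which heights 0 to 5 and
    the cells near the long side are disjoint.\<close>
  have "6 \<le> (k + 1) div 2 - 2" "(k + 1) div 2 - 2 \<le> (k + 2) div 2 + 1" using assms by auto
  from sum_split_bound[of "coverage c k" 0 6, OF coverage_le_1 _ this] show ?thesis
    unfolding sum_coverage sum_coverage_top by (simp add: sum_coverage_bottom)
qed

lemma potential_step:
  assumes "k \<ge> 15"
  shows "size_int (column c k) + 2 * size_int (column c (k - 1)) + 2 * size_int (column c (k + 1)) - (k + 1) div 2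
    + potential c k \<le> potential c (k + 1)"
proof -
  have "bottom_weight (lower_window c (k - 1)) (lower_window c k) (lower_window c (k + 1))
      + bottom_potential (lower_window c (k - 1)) (lower_window c k) \<le> bottom_potential (lower_window c k) (lower_window c (k + 1))"
    using bottom_check bottom_mem_columns compat_bottom(1)[of "k - 1"] compat_bottom(1)[of k] compat_bottom(2)[of "k - 1"]
    by (simp add: list_all_iff add.commute)
  moreover have "top_weight (odd k) (upper_window c (k - 1)) (upper_window c k) (upper_window c (k + 1))
      + top_potential (odd k) (upper_window c (k - 1)) (upper_window c k) \<le> top_potential (even k) (upper_window c k) (upper_window c (k + 1))"
    using top_check top_mem_columns[of k] top_mem_columns[of "k - 1"] top_mem_columns[of "k + 1"]
      compat_top_adjacent[of "k - 1"] compat_top_adjacent[of k] compat_top_second[of "k - 1"]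
    by (cases "odd k") (simp_all add: list_all_iff add.commute)
  ultimately show ?thesis
    using column_weight[OF assms] by (simp add: potential_def)
qed

text \<open>\<open>k * k div 4\<close> is the number of cells in the columns before
  \<open>k\<close>, and column \<open>k\<close> has \<open>(k + 1) div 2\<close> cells.\<close>

lemma square_div_4: "(k + 1) * (k + 1) div 4 = k * k div 4 + (k + 1) div 2" for k :: int
proof (cases "even k")
  case True
  then obtain j where "k = 2 * j" by (elim evenE)
  then show ?thesis by (simp add: algebra_simps)
next
  case False
  then obtain j where "k = 2 * j + 1" by (elim oddE)
  then show ?thesis by (simp add: algebra_simps)
qed

text \<open>The left-hand side is the excess of the columns before \<open>k\<close>; passing to
  \<open>k + 1\<close> adds exactly the weight of column \<open>k\<close> bounded in
  \<open>potential_step\<close>.\<close>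

lemma total_le_potential:
  assumes "k \<ge> 15"
  shows "5 * points_upto c k - 2 * size_int (column c (k - 1)) - 3 * size_int (column c k) - k * k div 4
    \<le> potential c k"
  using assms
proof (induction k rule: int_ge_induct)
  case base
  then show ?case using potential_15 by simp
next
  case (step k)
  then show ?case
    using potential_step[of k] total_step[of k c] square_div_4[of k] by simp
qed

end

section \<open>Joining two half packings at the middle column\<close>

lemma compat_top_sym: "compat_top A B \<longleftrightarrow> compat_top B A"
  by (auto simp: compat_top_def list_all_iff)

text \<open>The counterpart of \<open>coverage\<close> on the middle diagonal, whose neighbours on
  either side lie in column \<open>n - 1\<close> of one of the halves.\<close>

definition mirror_coverage :: "(int \<Rightarrow> int \<Rightarrow> bool) \<Rightarrow> (int \<Rightarrow> int \<Rightarrow> bool) \<Rightarrow> int \<Rightarrow> int \<Rightarrow> int" where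
  "mirror_coverage c c' n y = of_bool (c n y) + of_bool (c (n - 1) y) + of_bool (c (n - 1) (y - 1))
     + of_bool (c' (n - 1) y) + of_bool (c' (n - 1) (y - 1))"

text \<open>Twice the number of cells of the triangle: \<open>n * n div 4\<close> in each half
  before the middle column, plus the middle column itself.\<close>

lemma four_squares: "n * (n + 1) = 4 * (n * n div 4) + 2 * ((n + 1) div 2)" for n :: int
proof (cases "even n")
  case True
  then obtain j where "n = 2 * j" by (elim evenE)
  then show ?thesis by (simp add: algebra_simps)
next
  case False
  then obtain j where j: "n = 2 * j + 1" by (elim oddE)
  then have "n * n = 4 * (j * j + j) + 1" by (simp add: algebra_simps)
  then have "n * n div 4 = j * j + j" by simp
  then show ?thesis using j by (simp add: algebra_simps)
qed

lemma product_mod_10: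
  "n * (n + 1) mod 10 = (if n mod 5 \<in> {0, 4} then 0 else if n mod 5 \<in> {1, 3} then 2 else 6)" for n :: int
proof -
  define r where "r = n mod 10"
  have "r = 0 \<or> r = 1 \<or> r = 2 \<or> r = 3 \<or> r = 4 \<or> r = 5 \<or> r = 6 \<or> r = 7 \<or> r = 8 \<or> r = 9"
    unfolding r_def by presburger
  then have "r * ((r + 1) mod 10) mod 10 =
      (if r mod 5 \<in> {0, 4} then 0 else if r mod 5 \<in> {1, 3} then 2 else 6)" by (elim disjE) simp_all
  moreover have "r * ((r + 1) mod 10) mod 10 = n * (n + 1) mod 10"
    unfolding r_def by (simp add: mod_mult_eq mod_add_left_eq)
  moreover have "r mod 5 = n mod 5" unfolding r_def by (simp add: mod_mod_cancel)
  ultimately show ?thesis by simp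
qed

text \<open>Residues are at most 6, and 6 + 22 is below 30; the slack 22 is twice the excess
  11.\<close>

lemma div_10_bound: "p mod 10 \<in> {0, 2, 6} \<Longrightarrow> 10 * x \<le> p + 22 \<Longrightarrow> x \<le> p div 10 + 2" for p x :: int
proof -
  assume "p mod 10 \<in> {0, 2, 6}" "10 * x \<le> p + 22"
  moreover from this(1) have "p mod 10 \<le> 6" by auto
  moreover have "p = 10 * (p div 10) + p mod 10" by simp
  ultimately show ?thesis by linarith
qed

text \<open>\<open>c'\<close> stands for the other half, reflected. Apart from the shared column
  \<open>n\<close>, only the two columns \<open>n - 1\<close> can conflict across the
  diagonal.\<close>

locale two_halves = half_packing c + left: half_packing c'
  for c c' +
  fixes n :: int
  assumes middle: "c n = c' n"
    and mirror: "c (n - 1) y \<Longrightarrow> c' (n - 1) y' \<Longrightarrow> y' \<noteq> y \<and> y' \<noteq> y + 1 \<and> y' \<noteq> y - 1"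
begin

lemma middle_column: "column c' n = column c n"
  by (simp add: column_def middle)

lemma middle_bottom: "lower_window c' n = lower_window c n"
  by (simp add: lower_window_def middle)

lemma middle_top: "upper_window c' n = upper_window c n"
  by (simp add: upper_window_def middle)

lemma mirror_coverage_le_1: "mirror_coverage c c' n y \<le> 1"
  using adjacent[of "n - 1" y y] adjacent[of "n - 1" "y - 1" y] left.adjacent[of "n - 1" y y]
    left.adjacent[of "n - 1" "y - 1" y] same[of "n - 1" "y - 1" y] left.same[of "n - 1" "y - 1" y]
    mirror[of y y] mirror[of y "y - 1"] mirror[of "y - 1" y] mirror[of "y - 1" "y - 1"]
  by (auto simp: mirror_coverage_def of_bool_def middle)

lemma sum_mirror_coverage:
  "(\<Sum>y=1..(n + 2) div 2. mirror_coverage c c' n y) =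
     size_int (column c n) + 2 * size_int (column c (n - 1)) + 2 * size_int (column c' (n - 1))"
proof -
  let ?M = "(n + 2) div 2"
  have "(\<Sum>y=1..?M. of_bool (c n y)) = size_int (column c n)"
    "(\<Sum>y=1..?M. of_bool (c (n - 1) y)) = size_int (column c (n - 1))"
    "(\<Sum>y=1..?M. of_bool (c' (n - 1) y)) = size_int (column c' (n - 1))"
    by (rule sum_indicator_column; auto dest: range left.range)+
  moreover have "(\<Sum>y=1..?M. of_bool (c (n - 1) (y - 1))) = size_int (column c (n - 1))"
    unfolding sum_shift_int[of "\<lambda>y. of_bool (c (n - 1) y)" "- 1", simplified]
    by (rule sum_indicator_column) (auto dest: range)
  moreover have "(\<Sum>y=1..?M. of_bool (c' (n - 1) (y - 1))) = size_int (column c' (n - 1))"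
    unfolding sum_shift_int[of "\<lambda>y. of_bool (c' (n - 1) y)" "- 1", simplified]
    by (rule sum_indicator_column) (auto dest: left.range)
  ultimately show ?thesis
    by (simp add: mirror_coverage_def sum.distrib)
qed

lemma sum_mirror_coverage_bottom:
  "(\<Sum>y=1..5. mirror_coverage c c' n y) =
     mirror_weight (lower_window c (n - 1)) (lower_window c n) (lower_window c' (n - 1)) + 5"
  by (simp add: mirror_weight_def interval_unfold mirror_coverage_def ind_bottom left.ind_bottom)

lemma sum_mirror_coverage_top:
  "(\<Sum>y=(n + 1) div 2 - 2..(n + 2) div 2. mirror_coverage c c' n y) =
     top_weight (odd n) (upper_window c (n - 1)) (upper_window c n) (upper_window c' (n - 1)) + 3"
proof -
  let ?I = "{(n + 1) div 2 - 2..(n + 2) div 2}"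
  have "(\<Sum>y\<in>?I. mirror_coverage c c' n y) = (\<Sum>y\<in>?I. of_bool (c n y))
    + (\<Sum>y\<in>?I. of_bool (c (n - 1) y) + of_bool (c (n - 1) (y - 1)))
    + (\<Sum>y\<in>?I. of_bool (c' (n - 1) y) + of_bool (c' (n - 1) (y - 1)))"
    by (simp only: mirror_coverage_def sum.distrib add.assoc)
  then show ?thesis
    unfolding top_sum top_sum_prev left.top_sum_prev by (simp only: top_weight_split)
qed

lemma compat_mirror_bottom: "compat_mirror (lower_window c (n - 1)) (lower_window c' (n - 1))"
  unfolding compat_mirror_def list_all_iff lower_window_def using mirror by auto

lemma compat_mirror_column: "compat_mirror (column c (n - 1)) (column c' (n - 1))"
  unfolding compat_mirror_def list_all_iff set_column left.set_column using mirror by auto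

lemma compat_top_mirror: "compat_top (upper_window c (n - 1)) (upper_window c' (n - 1))"
  unfolding compat_top_def list_all_iff
  by (intro ballI, elim top_memD) (use mirror in fastforce)

lemma middle_weight:
  assumes "n \<ge> 15"
  shows "size_int (column c n) + 2 * size_int (column c (n - 1)) + 2 * size_int (column c' (n - 1)) - (n + 1) div 2
    + potential c n + potential c' n \<le> 11"
proof -
  have "6 \<le> (n + 1) div 2 - 2" "(n + 1) div 2 - 2 \<le> (n + 2) div 2 + 1" using assms by auto
  from sum_split_bound[of "mirror_coverage c c' n" 1 6, OF mirror_coverage_le_1 _ this]
  have "size_int (column c n) + 2 * size_int (column c (n - 1)) + 2 * size_int (column c' (n - 1)) - (n + 1) div 2
    \<le> mirror_weight (lower_window c (n - 1)) (lower_window c n) (lower_window c' (n - 1))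
     + top_weight (odd n) (upper_window c (n - 1)) (upper_window c n) (upper_window c' (n - 1))"
    unfolding sum_mirror_coverage sum_mirror_coverage_top by (simp add: sum_mirror_coverage_bottom)
  moreover have "mirror_weight (lower_window c (n - 1)) (lower_window c n) (lower_window c' (n - 1))
     + bottom_potential (lower_window c (n - 1)) (lower_window c n) + bottom_potential (lower_window c' (n - 1)) (lower_window c n) \<le> 0"
    using bottom_join_check bottom_mem_columns left.bottom_mem_columns compat_bottom(1)[of "n - 1"]
      left.compat_bottom(1)[of "n - 1"] compat_mirror_bottom middle_bottom
    by (simp add: list_all_iff)
  moreover have "top_weight (odd n) (upper_window c (n - 1)) (upper_window c n) (upper_window c' (n - 1))
     + top_potential (odd n) (upper_window c (n - 1)) (upper_window c n) + top_potential (odd n) (upper_window c' (n - 1)) (upper_window c n) \<le> 11"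
    using top_join_check top_mem_columns[of n] top_mem_columns[of "n - 1"] left.top_mem_columns[of "n - 1"]
      compat_top_adjacent[of "n - 1"] left.compat_top_adjacent[of "n - 1"] compat_top_mirror middle_top
      compat_top_sym[of "upper_window c' (n - 1)"]
    by (cases "odd n") (simp_all add: list_all_iff)
  ultimately show ?thesis
    by (simp add: potential_def middle_bottom middle_top)
qed

theorem total_bound:
  assumes "n \<ge> 6"
  shows "points_upto c n + points_upto c' n - size_int (column c n) \<le> n * (n + 1) div 10 + 2"
proof (cases "n \<ge> 15")
  case True
  \<comment> \<open>The two potential bounds leave out the middle column with weight 3 each; against
    the 5 subtracted for double counting it remains once, as \<open>middle_weight\<close>
    expects.\<close>
  have "5 * (points_upto c n + points_upto c' n - size_int (column c n)) \<le> 2 * (n * n div 4) + (n + 1) div 2 + 11"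
    using total_le_potential[OF True] left.total_le_potential[OF True] middle_weight[OF True] middle_column
    by simp
  then show ?thesis
    using four_squares[of n] product_mod_10[of n] by (intro div_10_bound) auto
next
  case False
  then obtain G where G: "joinable (n * (n + 1) div 10 + 2) G" "tabulated c n G" "tabulated c' n G"
    using verify_joinable[OF verify_initial_table, of n] assms tabulated_initial left.tabulated_initial
      half_packing_axioms left.half_packing_axioms by auto
  then obtain t v w where "map_of G (column c n) = Some t" "(column c (n - 1), v) \<in> set t"
    "(column c' (n - 1), w) \<in> set t" "points_upto c n \<le> v" "points_upto c' n \<le> w"
    by (auto simp: tabulated_def middle_column)
  with G(1) show ?thesis
    using joinable_withD[OF joinable_rowD[OF joinableD]] compat_mirror_column map_of_SomeD by fastforce
qed

end

section \<open>The upper bound\<close>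

definition right_half :: "int \<Rightarrow> (int \<times> int) set \<Rightarrow> int \<Rightarrow> int \<Rightarrow> bool" where
  "right_half n S k y \<longleftrightarrow> (n - k + y, y) \<in> S"

lemma half_packing_half:
  assumes "S \<subseteq> triangle n" "separated S"
  shows "half_packing (right_half n S)"
proof
  fix k y assume "right_half n S k y"
  then show "1 \<le> y \<and> 2 * y \<le> k + 1" using assms(1) by (auto simp: right_half_def triangle_def)
next
  fix k y y' assume "right_half n S k y" "right_half n S k y'" "y < y'"
  then show "y + 2 \<le> y'" using separatedD[OF assms(2), of "n - k + y" y "n - k + y'" y'] by (auto simp: right_half_def)
next
  fix k y y' assume "right_half n S k y" "right_half n S (k + 1) y'"
  then show "y' \<noteq> y \<and> y' \<noteq> y + 1"
    using separatedD[OF assms(2), of "n - k + y" y "n - (k + 1) + y'" y'] by (auto simp: right_half_def)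
next
  fix k y y' assume "right_half n S k y" "right_half n S (k + 2) y'"
  then show "y' \<noteq> y \<and> y' \<noteq> y + 1 \<and> y' \<noteq> y + 2"
    using separatedD[OF assms(2), of "n - k + y" y "n - (k + 2) + y'" y'] by (auto simp: right_half_def)
qed

lemma size_column_half:
  assumes "S \<subseteq> triangle n"
  shows "size_int (column (right_half n S) k) = int (card {p \<in> S. fst p - snd p = n - k})"
proof -
  have "1 \<le> y \<and> y \<le> (k + 1) div 2" if "(n - k + y, y) \<in> S" for y
    using assms that by (force simp: triangle_def)
  then have col: "set (column (right_half n S) k) = {y. (n - k + y, y) \<in> S}"
    by (auto simp: column_def right_half_def)
  have "{p \<in> S. fst p - snd p = n - k} = (\<lambda>y. (n - k + y, y)) ` set (column (right_half n S) k)"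
    unfolding col
  proof (intro equalityI subsetI)
    fix p assume p: "p \<in> {p \<in> S. fst p - snd p = n - k}"
    then have "p = (n - k + snd p, snd p)" by (simp add: prod_eq_iff)
    with p show "p \<in> (\<lambda>y. (n - k + y, y)) ` {y. (n - k + y, y) \<in> S}"
      by (intro image_eqI[of _ _ "snd p"]) auto
  qed auto
  also have "card \<dots> = card (set (column (right_half n S) k))"
    by (rule card_image) (simp add: inj_on_def)
  also have "\<dots> = length (column (right_half n S) k)"
    by (rule distinct_card) (simp add: column_def)
  finally show ?thesis by (simp add: size_int_eq)
qed

lemma total_half:
  assumes "S \<subseteq> triangle n"
  shows "points_upto (right_half n S) n = int (card {p \<in> S. snd p \<le> fst p})"
proof -
  have "{p \<in> S. snd p \<le> fst p} = (\<Union>k\<in>{1..n}. {p \<in> S. fst p - snd p = n - k})" (is "_ = ?U")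
  proof (intro equalityI subsetI)
    fix p assume p: "p \<in> {p \<in> S. snd p \<le> fst p}"
    then have "n - (fst p - snd p) \<in> {1..n}" using assms by (auto simp: triangle_def)
    with p show "p \<in> ?U" by force
  qed auto
  moreover have "card ?U = (\<Sum>k\<in>{1..n}. card {p \<in> S. fst p - snd p = n - k})"
    by (rule card_UN_disjoint) (use finite_subset[OF assms finite_triangle] in auto)
  ultimately show ?thesis
    by (simp add: points_upto_def size_column_half[OF assms])
qed

lemma card_separated_le:
  assumes S: "S \<subseteq> triangle n" "separated S" and "n \<ge> 6"
  shows "int (card S) \<le> n * (n + 1) div 10 + 2"
proof -
  \<comment> \<open>Reflection turns the cells above the diagonal into a right half.\<close>
  let ?S' = "prod.swap ` S"
  have S': "?S' \<subseteq> triangle n" using S(1) by (auto simp: triangle_def)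
  have sep': "separated ?S'"
  proof (rule separatedI)
    fix x y x' y' assume "(x, y) \<in> ?S'" "(x', y') \<in> ?S'" "(x, y) \<noteq> (x', y')"
    then show "3 \<le> \<bar>x - x'\<bar> + \<bar>y - y'\<bar>" using separatedD[OF S(2), of y x y' x'] by auto
  qed
  interpret two_halves "right_half n S" "right_half n ?S'" n
  proof (intro two_halves.intro two_halves_axioms.intro half_packing_half S S' sep')
    show "right_half n S n = right_half n ?S' n" by (simp add: right_half_def fun_eq_iff)
    fix y y' assume "right_half n S (n - 1) y" "right_half n ?S' (n - 1) y'"
    then show "y' \<noteq> y \<and> y' \<noteq> y + 1 \<and> y' \<noteq> y - 1"
      using separatedD[OF S(2), of "y + 1" y y' "y' + 1"] by (auto simp: right_half_def add.commute)
  qed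
  have fin: "finite S" using finite_subset[OF S(1) finite_triangle] .
  have "card {p \<in> ?S'. snd p \<le> fst p} = card {p \<in> S. fst p \<le> snd p}"
    by (simp add: Compr_image_eq card_image)
  then have "points_upto (right_half n ?S') n = int (card {p \<in> S. fst p \<le> snd p})"
    using total_half[OF S'] by simp
  moreover have "size_int (column (right_half n S) n) = int (card {p \<in> S. fst p = snd p})"
    using size_column_half[OF S(1), of n] by simp
  moreover have "card {p \<in> S. snd p \<le> fst p} + card {p \<in> S. fst p \<le> snd p} = card S + card {p \<in> S. fst p = snd p}"
  proof -
    have "{p \<in> S. snd p \<le> fst p} \<union> {p \<in> S. fst p \<le> snd p} = S"
      "{p \<in> S. snd p \<le> fst p} \<inter> {p \<in> S. fst p \<le> snd p} = {p \<in> S. fst p = snd p}" by auto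
    then show ?thesis
      using card_Un_Int[of "{p \<in> S. snd p \<le> fst p}" "{p \<in> S. fst p \<le> snd p}"] fin by simp
  qed
  ultimately show ?thesis
    using total_bound[OF assms(3)] total_half[OF S(1)] by simp
qed

section \<open>Packings from the perfect code\<close>

definition lattice_points :: "int \<Rightarrow> int \<Rightarrow> (int \<times> int) set" where
  "lattice_points c n = {(x, y) \<in> triangle n. (x + 2 * y) mod 5 = c}"

lemma lattice_subset: "lattice_points c n \<subseteq> triangle n"
  by (auto simp: lattice_points_def)

lemma finite_lattice: "finite (lattice_points c n)"
  using finite_subset[OF lattice_subset finite_triangle] .

text \<open>Each full antidiagonal \<open>x + y = d\<close> of the five bottom rows contains exactly one lattice point.\<close>

lemma card_lattice_add_5:
  assumes "n \<ge> 0" "c \<in> {0, 3, 4}"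
  shows "int (card (lattice_points c n)) + n + 3 \<le> int (card (lattice_points c (n + 5)))"
proof -
  \<comment> \<open>On \<open>x + y = d\<close> the lattice condition reads
    \<open>d + y \<equiv> c\<close>; \<open>row d\<close> is its solution between 1 and 5.\<close>
  define row where "row d = (c - d - 1) mod 5 + 1" for d :: int
  define A where "A = (\<lambda>(x, y). (x, y + 5)) ` lattice_points c n"
  define B where "B = (\<lambda>d. (d - row d, row d)) ` {6..n + 6}"
  \<comment> \<open>The two lattice points with \<open>x + y \<le> 5\<close>, where the
    antidiagonals are too short for \<open>row\<close>.\<close>
  define C where "C = (if c = 0 then {(1, 2), (3, 1)} else if c = 3 then {(1, 1), (2, 3)} else {(2, 1), (1, 4)} :: (int \<times> int) set)"
  have row: "1 \<le> row d" "row d \<le> 5" for d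
    unfolding row_def using pos_mod_sign[of 5 "c - d - 1"] pos_mod_bound[of 5 "c - d - 1"] by linarith+
  have row_mod: "(d - row d + 2 * row d) mod 5 = c" for d
  proof -
    have "(d - row d + 2 * row d) mod 5 = (d + 1 + (c - d - 1) mod 5) mod 5"
      by (simp add: row_def algebra_simps)
    also have "\<dots> = c mod 5" by (simp add: mod_add_right_eq)
    finally show ?thesis using assms(2) by auto
  qed
  have "A \<subseteq> lattice_points c (n + 5)"
  proof -
    have "(x + 2 * (y + 5)) mod 5 = (x + 2 * y) mod 5" for x y :: int by presburger
    then show ?thesis by (auto simp: A_def lattice_points_def triangle_def)
  qed
  moreover have "B \<subseteq> lattice_points c (n + 5)"
  proof
    fix p assume "p \<in> B"
    then obtain d where "p = (d - row d, row d)" "6 \<le> d" "d \<le> n + 6" by (auto simp: B_def)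
    then show "p \<in> lattice_points c (n + 5)"
      using row[of d] row_mod[of d] by (simp add: lattice_points_def triangle_def)
  qed
  moreover have "C \<subseteq> lattice_points c (n + 5)"
    using assms by (auto simp: C_def lattice_points_def triangle_def)
  ultimately have "A \<union> (B \<union> C) \<subseteq> lattice_points c (n + 5)" by blast
  then have "card (A \<union> (B \<union> C)) \<le> card (lattice_points c (n + 5))"
    by (rule card_mono[OF finite_lattice])
  moreover have "card (A \<union> (B \<union> C)) = card A + card (B \<union> C)"
  proof (rule card_Un_disjoint)
    have "snd p \<ge> 6" if "p \<in> A" for p using that by (auto simp: A_def lattice_points_def triangle_def)
    moreover have "snd p \<le> 5" if "p \<in> B \<union> C" for p
      using that row by (auto simp: B_def C_def split: if_splits)
    ultimately show "A \<inter> (B \<union> C) = {}" by fastforce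
  qed (simp_all add: A_def B_def C_def finite_lattice)
  moreover have "card (B \<union> C) = card B + card C"
  proof (rule card_Un_disjoint)
    have "fst p + snd p \<ge> 6" if "p \<in> B" for p using that by (auto simp: B_def)
    moreover have "fst p + snd p \<le> 5" if "p \<in> C" for p using that by (auto simp: C_def split: if_splits)
    ultimately show "B \<inter> C = {}" by fastforce
  qed (simp_all add: B_def C_def)
  moreover have "card A = card (lattice_points c n)"
    unfolding A_def by (rule card_image) (auto simp: inj_on_def)
  moreover have "card B = nat (n + 1)"
  proof -
    have "inj_on (\<lambda>d. (d - row d, row d)) {6..n + 6}" by (auto simp: inj_on_def)
    then show ?thesis unfolding B_def by (simp add: card_image)
  qed
  moreover have "card C = 2" by (simp add: C_def)
  ultimately show ?thesis using assms(1) by linarith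
qed

text \<open>Raising \<open>n\<close> by 5 raises \<open>n * (n + 1) div 10\<close> by exactly
  \<open>n + 3\<close>, so a surplus \<open>k\<close> persists.\<close>

lemma card_lattice_ge:
  assumes "n \<ge> 0" "c \<in> {0, 3, 4}" "n * (n + 1) div 10 + k \<le> int (card (lattice_points c n))"
  shows "(n + 5 * int m) * (n + 5 * int m + 1) div 10 + k \<le> int (card (lattice_points c (n + 5 * int m)))"
proof (induction m)
  case 0
  then show ?case using assms(3) by simp
next
  case (Suc m)
  define N where "N = n + 5 * int m"
  have "(N + 5) * (N + 5 + 1) = N * (N + 1) + (N + 3) * 10" by (simp add: algebra_simps)
  then have "(N + 5) * (N + 5 + 1) div 10 = N * (N + 1) div 10 + (N + 3)"
    by (simp only: div_mult_self1 zero_neq_numeral[symmetric] not_False_eq_True)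
  moreover have "N \<ge> 0" using assms(1) by (simp add: N_def)
  ultimately have "(N + 5) * (N + 5 + 1) div 10 + k \<le> int (card (lattice_points c (N + 5)))"
    using card_lattice_add_5[OF _ assms(2), of N] Suc.IH by (simp add: N_def)
  moreover have "n + 5 * int (Suc m) = N + 5" by (simp add: N_def)
  ultimately show ?case by (simp only:)
qed

section \<open>Exchanging lattice points near the corners\<close>

lemma near_cases:
  fixes x y a b :: int
  assumes "\<bar>x - a\<bar> + \<bar>y - b\<bar> < 3"
  shows "(x, y) \<in> {(a, b), (a + 1, b), (a - 1, b), (a, b + 1), (a, b - 1), (a + 2, b), (a - 2, b),
    (a, b + 2), (a, b - 2), (a + 1, b + 1), (a + 1, b - 1), (a - 1, b + 1), (a - 1, b - 1)}"
proof -
  have x: "x = a - 2 \<or> x = a - 1 \<or> x = a \<or> x = a + 1 \<or> x = a + 2"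
    using assms by arith
  have y: "x = a - 2 \<Longrightarrow> y = b" "x = a + 2 \<Longrightarrow> y = b" using assms by arith+
  have y1: "y = b - 1 \<or> y = b \<or> y = b + 1" if "x = a - 1 \<or> x = a + 1"
  proof -
    have "\<bar>x - a\<bar> = 1" using that by auto
    then have "\<bar>y - b\<bar> < 2" using assms by linarith
    then show ?thesis by arith
  qed
  have y0: "y = b - 2 \<or> y = b - 1 \<or> y = b \<or> y = b + 1 \<or> y = b + 2" if "x = a"
  proof -
    have "\<bar>y - b\<bar> < 3" using assms that by simp
    then show ?thesis by arith
  qed
  show ?thesis using x y y1 y0 by (elim disjE) (simp_all, blast+)
qed

definition far :: "int \<times> int \<Rightarrow> int \<times> int \<Rightarrow> bool" where
  "far p q \<longleftrightarrow> 3 \<le> \<bar>fst p - fst q\<bar> + \<bar>snd p - snd q\<bar>"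

text \<open>A nonzero vector of length at most two has \<open>dx + 2 * dy\<close> not divisible by
  5.\<close>

lemma separated_lattice: "separated (lattice_points c n)"
proof (rule separatedI)
  fix x y x' y' assume *: "(x, y) \<in> lattice_points c n" "(x', y') \<in> lattice_points c n" "(x, y) \<noteq> (x', y')"
  show "3 \<le> \<bar>x - x'\<bar> + \<bar>y - y'\<bar>"
  proof (rule ccontr)
    assume "\<not> ?thesis"
    then have near: "\<bar>x - x'\<bar> + \<bar>y - y'\<bar> < 3" by simp
    have "(x + 2 * y) mod 5 = (x' + 2 * y') mod 5" using * by (simp add: lattice_points_def)
    then have "5 dvd (x - x') + 2 * (y - y')" by (simp add: mod_eq_dvd_iff algebra_simps)
    then show False using near_cases[OF near] *(3) by auto
  qed
qed

text \<open>
  Lists the three lattice points within distance two of a cell off the lattice; they have to lie outside the triangle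
  or be removed.
\<close>

definition shielded :: "int \<Rightarrow> (int \<times> int) set \<Rightarrow> int \<Rightarrow> int \<times> int \<Rightarrow> bool" where
  "shielded n R c = (\<lambda>(a, b). \<exists>s\<in>{1, - 1}.
     ((a + 2 * b + s) mod 5 = c \<and>
       (\<forall>p\<in>{(a + s, b), (a, b - 2 * s), (a - s, b + s)}. p \<in> triangle n \<longrightarrow> p \<in> R)) \<or>
     ((a + 2 * b + 2 * s) mod 5 = c \<and>
       (\<forall>p\<in>{(a, b + s), (a + 2 * s, b), (a - s, b - s)}. p \<in> triangle n \<longrightarrow> p \<in> R)))"

text \<open>The twelve nonzero vectors of length at most two are spread evenly over the four nonzero
  residues of \<open>dx + 2 * dy\<close>, three on each; \<open>shielded\<close> lists these
  triples.\<close>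

lemma far_lattice:
  assumes "(x, y) \<in> lattice_points c n" "(x, y) \<notin> R"
    and "shielded n R c (a, b)"
  shows "far (x, y) (a, b)"
proof (rule ccontr)
  assume "\<not> ?thesis"
  then have near: "\<bar>x - a\<bar> + \<bar>y - b\<bar> < 3" by (simp add: far_def)
  have xy: "(x + 2 * y) mod 5 = c" "(x, y) \<in> triangle n" using assms(1) by (auto simp: lattice_points_def)
  define e where "e = a + 2 * b"
  have e: "e + (x - a) + 2 * (y - b) = x + 2 * y" by (simp add: e_def)
  have plus: "(e + i) mod 5 = (e + j) mod 5 \<longleftrightarrow> 5 dvd (i - j)" for i j
    by (metis add_diff_cancel_left mod_eq_dvd_iff)
  have dvd: "5 dvd (x - a) + 2 * (y - b) - i" if "(a + 2 * b + i) mod 5 = c" for i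
    using plus[of "(x - a) + 2 * (y - b)" i] xy(1) e that by (simp add: e_def add.assoc)
  obtain s :: int where s: "s = 1 \<or> s = - 1"
    and "((a + 2 * b + s) mod 5 = c \<and>
       (\<forall>p\<in>{(a + s, b), (a, b - 2 * s), (a - s, b + s)}. p \<in> triangle n \<longrightarrow> p \<in> R)) \<or>
     ((a + 2 * b + 2 * s) mod 5 = c \<and>
       (\<forall>p\<in>{(a, b + s), (a + 2 * s, b), (a - s, b - s)}. p \<in> triangle n \<longrightarrow> p \<in> R))"
    using assms(3) unfolding shielded_def by blast
  then consider "5 dvd (x - a) + 2 * (y - b) - s"
      "\<forall>p\<in>{(a + s, b), (a, b - 2 * s), (a - s, b + s)}. p \<in> triangle n \<longrightarrow> p \<in> R"
    | "5 dvd (x - a) + 2 * (y - b) - 2 * s"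
      "\<forall>p\<in>{(a, b + s), (a + 2 * s, b), (a - s, b - s)}. p \<in> triangle n \<longrightarrow> p \<in> R"
    using dvd by blast
  then show False
  proof cases
    case 1
    from 1(1) have "(x, y) \<in> {(a + s, b), (a, b - 2 * s), (a - s, b + s)}"
      using near_cases[OF near] s by auto
    then show False using 1(2) xy(2) assms(2) by blast
  next
    case 2
    from 2(1) have "(x, y) \<in> {(a, b + s), (a + 2 * s, b), (a - s, b - s)}"
      using near_cases[OF near] s by auto
    then show False using 2(2) xy(2) assms(2) by blast
  qed
qed

text \<open>The surplus \<open>k\<close> of the lattice and the gain of exchanging \<open>R\<close>
  for \<open>A\<close> must add up to 2.\<close>

lemma patched_packing:
  assumes "A \<subseteq> triangle n" "separated A" "\<And>q. q \<in> A \<Longrightarrow> shielded n R c q" "finite R"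
    and "n * (n + 1) div 10 + k \<le> int (card (lattice_points c n))" "int (card R) + 2 \<le> int (card A) + k"
  shows "\<exists>S \<subseteq> triangle n. separated S \<and> n * (n + 1) div 10 + 2 \<le> int (card S)"
proof (intro exI conjI)
  let ?L = "lattice_points c n - R"
  have finA: "finite A" using assms(1) finite_triangle finite_subset by blast
  have far: "far p q" if "p \<in> ?L" "q \<in> A" for p q
    using far_lattice[of "fst p" "snd p" c n R "fst q" "snd q"] that assms(3) by simp
  then have "?L \<inter> A = {}" by (fastforce simp: far_def)
  then have "card (?L \<union> A) = card ?L + card A"
    using finite_lattice finA by (intro card_Un_disjoint) auto
  moreover have "card (lattice_points c n) - card R \<le> card ?L"
    by (rule diff_card_le_card_Diff) (fact assms(4))
  ultimately show "n * (n + 1) div 10 + 2 \<le> int (card (?L \<union> A))"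
    using assms(5,6) by linarith
  show "?L \<union> A \<subseteq> triangle n" using assms(1) lattice_subset by blast
  show "separated (?L \<union> A)"
    unfolding separated_def
  proof (intro ballI impI)
    fix p q assume "p \<in> ?L \<union> A" "q \<in> ?L \<union> A" "p \<noteq> q"
    then show "3 \<le> \<bar>fst p - fst q\<bar> + \<bar>snd p - snd q\<bar>"
      using far[of p q] far[of q p] assms(2) separated_lattice[of c n]
      unfolding separated_def far_def by (elim UnE DiffE) (auto simp: abs_minus_commute)
  qed
qed

text \<open>Both acute corners can be added without removing anything.\<close>

lemma packing_1_mod_5:
  assumes n: "n = 5 * int m + 1" and m: "m \<ge> 1"
  shows "\<exists>S \<subseteq> triangle n. separated S \<and> n * (n + 1) div 10 + 2 \<le> int (card S)"
proof (rule patched_packing)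
  let ?A = "{(n, 1), (1, n)} :: (int \<times> int) set"
  let ?R = "{} :: (int \<times> int) set"
  show "?A \<subseteq> triangle n" using m unfolding n by (simp add: triangle_def)
  show "separated ?A" using m unfolding n by (simp add: separated_def)
  show "shielded n ?R 0 q" if "q \<in> ?A" for q
    using that m unfolding n by (elim insertE emptyE; simp add: shielded_def triangle_def; presburger?)
  show "finite ?R" by simp
  have "{} \<subseteq> lattice_points 0 1" by (auto simp: lattice_points_def triangle_def)
  from card_mono[OF finite_lattice this] have "1 * (1 + 1) div 10 + 0 \<le> int (card (lattice_points 0 1))" by simp
  from card_lattice_ge[OF _ _ this, of m] show "n * (n + 1) div 10 + 0 \<le> int (card (lattice_points 0 n))"
    by (simp add: n add.commute)
  show "int (card ?R) + 2 \<le> int (card ?A) + 0" using m unfolding n by simp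
qed

text \<open>The lattice has surplus 1 already for \<open>n = 2\<close>; three cells for two at the
  corner \<open>(n, 1)\<close> give the rest.\<close>

lemma packing_2_mod_5:
  assumes n: "n = 5 * int m + 2" and m: "m \<ge> 1"
  shows "\<exists>S \<subseteq> triangle n. separated S \<and> n * (n + 1) div 10 + 2 \<le> int (card S)"
proof (rule patched_packing)
  let ?A = "{(n - 3, 1), (n - 2, 3), (n, 1)} :: (int \<times> int) set"
  let ?R = "{(n - 3, 2), (n - 1, 1)} :: (int \<times> int) set"
  show "?A \<subseteq> triangle n" using m unfolding n by (simp add: triangle_def)
  show "separated ?A" using m unfolding n by (simp add: separated_def)
  show "shielded n ?R 3 q" if "q \<in> ?A" for q
    using that m unfolding n by (elim insertE emptyE; simp add: shielded_def triangle_def; presburger?)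
  show "finite ?R" by simp
  have "{(1, 1)} \<subseteq> lattice_points 3 2" by (auto simp: lattice_points_def triangle_def)
  from card_mono[OF finite_lattice this] have "2 * (2 + 1) div 10 + 1 \<le> int (card (lattice_points 3 2))" by simp
  from card_lattice_ge[OF _ _ this, of m] show "n * (n + 1) div 10 + 1 \<le> int (card (lattice_points 3 n))"
    by (simp add: n add.commute)
  show "int (card ?R) + 2 \<le> int (card ?A) + 1" using m unfolding n by simp
qed

text \<open>Gain 1 from three cells for two at \<open>(n, 1)\<close> and 1 from the free corner
  \<open>(1, n)\<close>; replacing \<open>(2, 1)\<close> by \<open>(1, 1)\<close> is
  neutral.\<close>

lemma packing_3_mod_5:
  assumes n: "n = 5 * int m + 3" and m: "m \<ge> 1"
  shows "\<exists>S \<subseteq> triangle n. separated S \<and> n * (n + 1) div 10 + 2 \<le> int (card S)"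
proof (rule patched_packing)
  let ?A = "{(1, 1), (n - 3, 1), (n - 2, 3), (n, 1), (1, n)} :: (int \<times> int) set"
  let ?R = "{(2, 1), (n - 3, 2), (n - 1, 1)} :: (int \<times> int) set"
  show "?A \<subseteq> triangle n" using m unfolding n by (simp add: triangle_def)
  show "separated ?A" using m unfolding n by (simp add: separated_def)
  show "shielded n ?R 4 q" if "q \<in> ?A" for q
    using that m unfolding n by (elim insertE emptyE; simp add: shielded_def triangle_def; presburger?)
  show "finite ?R" by simp
  have "{(2, 1)} \<subseteq> lattice_points 4 3" by (auto simp: lattice_points_def triangle_def)
  from card_mono[OF finite_lattice this] have "3 * (3 + 1) div 10 + 0 \<le> int (card (lattice_points 4 3))" by simp
  from card_lattice_ge[OF _ _ this, of m] show "n * (n + 1) div 10 + 0 \<le> int (card (lattice_points 4 n))"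
    by (simp add: n add.commute)
  show "int (card ?R) + 2 \<le> int (card ?A) + 0" using m unfolding n by simp
qed

text \<open>The corner \<open>(n, 1)\<close> is free, and at \<open>(1, n)\<close> four cells
  replace three.\<close>

lemma packing_4_mod_5:
  assumes n: "n = 5 * int m + 4" and m: "m \<ge> 1"
  shows "\<exists>S \<subseteq> triangle n. separated S \<and> n * (n + 1) div 10 + 2 \<le> int (card S)"
proof (rule patched_packing)
  let ?A = "{(n, 1), (1, n - 4), (1, n), (2, n - 2), (4, n - 3)} :: (int \<times> int) set"
  let ?R = "{(1, n - 3), (2, n - 1), (3, n - 4)} :: (int \<times> int) set"
  show "?A \<subseteq> triangle n" using m unfolding n by (simp add: triangle_def)
  show "separated ?A" using m unfolding n by (simp add: separated_def)
  show "shielded n ?R 3 q" if "q \<in> ?A" for q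
    using that m unfolding n by (elim insertE emptyE; simp add: shielded_def triangle_def; presburger?)
  show "finite ?R" by simp
  have "{(1, 1), (2, 3)} \<subseteq> lattice_points 3 4" by (auto simp: lattice_points_def triangle_def)
  from card_mono[OF finite_lattice this] have "4 * (4 + 1) div 10 + 0 \<le> int (card (lattice_points 3 4))" by simp
  from card_lattice_ge[OF _ _ this, of m] show "n * (n + 1) div 10 + 0 \<le> int (card (lattice_points 3 n))"
    by (simp add: n add.commute)
  show "int (card ?R) + 2 \<le> int (card ?A) + 0" using m unfolding n by simp
qed

text \<open>A neutral exchange of four cells at the right angle, three for two at
  \<open>(n, 1)\<close> and four for three at \<open>(1, n)\<close>. For \<open>n = 10\<close> the
  patches collide: \<open>(4, 1)\<close> and \<open>(n - 4, 1)\<close> are too close, so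
  \<open>packing_10\<close> lists a packing explicitly.\<close>

lemma packing_0_mod_5:
  assumes n: "n = 5 * int m" and m: "m \<ge> 3"
  shows "\<exists>S \<subseteq> triangle n. separated S \<and> n * (n + 1) div 10 + 2 \<le> int (card S)"
proof (rule patched_packing)
  let ?A = "{(1, 1), (1, 4), (3, 3), (4, 1), (n - 4, 1), (n - 2, 2), (n, 1), (1, n - 4), (1, n), (2, n - 2), (4, n - 3)} :: (int \<times> int) set"
  let ?R = "{(1, 2), (2, 4), (3, 1), (4, 3), (n - 4, 2), (n - 2, 1), (1, n - 3), (2, n - 1), (3, n - 4)} :: (int \<times> int) set"
  show "?A \<subseteq> triangle n" using m unfolding n by (simp add: triangle_def)
  show "separated ?A" using m unfolding n by (simp add: separated_def)
  show "shielded n ?R 0 q" if "q \<in> ?A" for q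
    using that m unfolding n by (elim insertE emptyE; simp add: shielded_def triangle_def; presburger?)
  show "finite ?R" by simp
  have "{} \<subseteq> lattice_points 0 0" by (auto simp: lattice_points_def triangle_def)
  from card_mono[OF finite_lattice this] have "0 * (0 + 1) div 10 + 0 \<le> int (card (lattice_points 0 0))" by simp
  from card_lattice_ge[OF _ _ this, of m] show "n * (n + 1) div 10 + 0 \<le> int (card (lattice_points 0 n))"
    by (simp add: n add.commute)
  show "int (card ?R) + 2 \<le> int (card ?A) + 0" using m unfolding n by simp
qed

lemma packing_10: "\<exists>S \<subseteq> triangle 10. separated S \<and> 10 * (10 + 1) div 10 + 2 \<le> int (card S)"
  by (rule exI[of _ "{(1, 3), (1, 6), (1, 10), (2, 1), (2, 8), (3, 4), (4, 2), (4, 7), (5, 5), (6, 1), (7, 4), (8, 2), (10, 1)}"])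
    (simp add: triangle_def separated_def)

section \<open>The lower bound for all sizes and the closed formula\<close>

lemma packing_exists:
  assumes "n \<ge> 6"
  shows "\<exists>S \<subseteq> triangle (int n). separated S \<and> int n * (int n + 1) div 10 + 2 \<le> int (card S)"
proof -
  define m where "m = n div 5"
  have "n = 5 * m + n mod 5" by (simp add: m_def)
  moreover have "n mod 5 = 0 \<or> n mod 5 = 1 \<or> n mod 5 = 2 \<or> n mod 5 = 3 \<or> n mod 5 = 4"
    by presburger
  ultimately consider "n = 5 * m" | "n = 5 * m + 1" | "n = 5 * m + 2" | "n = 5 * m + 3" | "n = 5 * m + 4"
    by fastforce
  then show ?thesis
  proof cases
    case 1
    show ?thesis
    proof (cases "n = 10")
      case True
      then show ?thesis using packing_10 by simp
    next
      case False
      then show ?thesis using packing_0_mod_5[of "int n" m] 1 assms by simp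
    qed
  next
    case 2
    then show ?thesis using packing_1_mod_5[of "int n" m] assms by simp
  next
    case 3
    then show ?thesis using packing_2_mod_5[of "int n" m] assms by simp
  next
    case 4
    then show ?thesis using packing_3_mod_5[of "int n" m] assms by simp
  next
    case 5
    then show ?thesis using packing_4_mod_5[of "int n" m] assms by simp
  qed
qed

text \<open>The constants 20, 18 and 14 are 20 minus the residues 0, 2 and 6 of
  \<open>n * (n + 1)\<close> modulo 10.\<close>

lemma A085680_formula_eq: "A085680_formula n = real (n * (n + 1) div 10 + 2)"
proof -
  define q where "q = n * (n + 1) div 10"
  have "int n * (int n + 1) div 10 = int q" unfolding q_def by (simp add: zdiv_int algebra_simps)
  then have "int n * (int n + 1) = 10 * int q + int n * (int n + 1) mod 10"
    by (metis mult_div_mod_eq)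
  then have "real_of_int (int n * (int n + 1)) = real_of_int (10 * int q + int n * (int n + 1) mod 10)"
    by (simp only:)
  moreover have "int n mod 5 = int (n mod 5)" by (simp add: zmod_int)
  ultimately have "real n ^ 2 + real n = 10 * real q +
      (if n mod 5 \<in> {0, 4} then 0 else if n mod 5 \<in> {1, 3} then 2 else 6)"
    unfolding product_mod_10 by (auto simp: power2_eq_square algebra_simps split: if_splits)
  then show ?thesis
    unfolding A085680_formula_def q_def[symmetric] by (auto split: if_splits)
qed

theorem theorem1p3:
  fixes n :: nat
  assumes "n \<ge> 6"
  shows "real (A085680 (n + 1)) = A085680_formula n"
proof -
  have "A085680 (n + 1) = n * (n + 1) div 10 + 2"
  proof (rule A085680_eq)
    have bound: "int n * (int n + 1) div 10 + 2 = int (n * (n + 1) div 10 + 2)"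
      by (simp add: zdiv_int algebra_simps)
    show "card S \<le> n * (n + 1) div 10 + 2" if "S \<subseteq> triangle (int n)" "separated S" for S
      using card_separated_le[OF that] assms unfolding bound by linarith
    show "\<exists>S \<subseteq> triangle (int n). separated S \<and> n * (n + 1) div 10 + 2 \<le> card S"
      using packing_exists[OF assms] unfolding bound of_nat_le_iff .
  qed
  then show ?thesis by (simp only: A085680_formula_eq)
qed

end
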